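(* Let $B = \mathcal{M}(D)/D$ be the corona algebra of a $\sigma$-unital C*-algebra $D$. Let $\pi\colon B\to B(\mathcal{H})$ be a nondegenerate faithful representation of $B$ on a Hilbert space $\mathcal{H}$, and identify $B$ with its image $\pi(B)\subset B(\mathcal{H})$. Then for every $\sigma$-unital hereditary C*-subalgebra $H$ of $B$ there exists a projection $p\in B(\mathcal{H})$ such that $H = p\,B(\mathcal{H})\,p\cap B$.
   Context: $\mathcal{M}(D)$ denotes the multiplier algebra of the C*-algebra $D$. A C*-algebra is $\sigma$-unital if it has a countable approximate unit. *)

theory Defs
  imports "HOL-Analysis.Analysis"
begin

section \<open>Complex normed spaces, C*-algebras, Hilbert spaces\<close>

class scaleC =
  fixes scaleC :: "complex \<Rightarrow> 'a \<Rightarrow> 'a" (infixr "*\<^sub>C" 75)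

class complex_normed_vector = real_normed_vector + scaleC +
  assumes scaleC_add_right: "c *\<^sub>C (x + y) = c *\<^sub>C x + c *\<^sub>C y"
    and scaleC_add_left: "(c + d) *\<^sub>C x = c *\<^sub>C x + d *\<^sub>C x"
    and scaleC_scaleC: "c *\<^sub>C d *\<^sub>C x = (c * d) *\<^sub>C x"
    and scaleC_of_real: "of_real r *\<^sub>C x = r *\<^sub>R x"
    and norm_scaleC: "norm (c *\<^sub>C x) = cmod c * norm x"

class normed_star_algebra = complex_normed_vector + real_normed_algebra +
  fixes star :: "'a \<Rightarrow> 'a"
  assumes mult_scaleC_left: "(c *\<^sub>C x) * y = c *\<^sub>C (x * y)"
    and mult_scaleC_right: "x * (c *\<^sub>C y) = c *\<^sub>C (x * y)"
    and star_star: "star (star x) = x"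
    and star_add: "star (x + y) = star x + star y"
    and star_scaleC: "star (c *\<^sub>C x) = cnj c *\<^sub>C star x"
    and star_mult: "star (x * y) = star y * star x"
    and norm_star: "norm (star x) = norm x"

text \<open>No unit is assumed.\<close>

class cstar_algebra = normed_star_algebra + banach +
  assumes cstar_identity: "norm (star x * x) = (norm x)\<^sup>2"

text \<open>The inner product is linear in its first argument.\<close>

class complex_inner = complex_normed_vector +
  fixes cinner :: "'a \<Rightarrow> 'a \<Rightarrow> complex"
  assumes cinner_commute: "cinner x y = cnj (cinner y x)"
    and cinner_add_left: "cinner (x + y) z = cinner x z + cinner y z"
    and cinner_scaleC_left: "cinner (c *\<^sub>C x) y = c * cinner x y"
    and cinner_norm: "cinner x x = of_real ((norm x)\<^sup>2)"

class chilbert_space = complex_inner + complete_space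

lemma scaleC_one: "1 *\<^sub>C x = (x::'a::complex_normed_vector)"
  using scaleC_of_real[of 1 x] by simp

lemma scaleC_zero_left: "0 *\<^sub>C x = (0::'a::complex_normed_vector)"
  using scaleC_of_real[of 0 x] by simp

lemma scaleC_zero_right: "c *\<^sub>C 0 = (0::'a::complex_normed_vector)"
  using scaleC_add_right[of c 0 0] by simp

lemma scaleC_minus_right: "c *\<^sub>C (- x) = - (c *\<^sub>C (x::'a::complex_normed_vector))"
  using scaleC_add_right[of c x "- x"] by (simp add: scaleC_zero_right minus_unique)

lemma scaleC_diff_right: "c *\<^sub>C (x - y) = c *\<^sub>C x - c *\<^sub>C (y::'a::complex_normed_vector)"
  using scaleC_add_right[of c x "- y"] by (simp add: scaleC_minus_right)

lemma scaleC_scaleR: "c *\<^sub>C (r *\<^sub>R x) = r *\<^sub>R (c *\<^sub>C (x::'a::complex_normed_vector))"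
  by (metis scaleC_of_real scaleC_scaleC mult.commute)

lemma star_zero: "star 0 = (0::'a::normed_star_algebra)"
  using star_add[of 0 "0::'a"] by simp

lemma star_minus: "star (- x) = - star (x::'a::normed_star_algebra)"
  using star_add[of x "- x"] by (simp add: star_zero minus_unique)

lemma star_diff: "star (x - y) = star x - star (y::'a::normed_star_algebra)"
  using star_add[of x "- y"] by (simp add: star_minus)

lemma star_scaleR: "star (r *\<^sub>R x) = r *\<^sub>R star (x::'a::normed_star_algebra)"
  using star_scaleC[of "of_real r" x] by (simp add: scaleC_of_real)



section \<open>Bounded complex-linear operators\<close>

instantiation blinfun :: (real_normed_vector, complex_normed_vector) complex_normed_vector
begin

lift_definition scaleC_blinfun :: "complex \<Rightarrow> ('a \<Rightarrow>\<^sub>L 'b) \<Rightarrow> 'a \<Rightarrow>\<^sub>L 'b"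
  is "\<lambda>c f x. c *\<^sub>C f x"
proof -
  fix c :: complex and f :: "'a \<Rightarrow> 'b"
  assume "bounded_linear f"
  then interpret bounded_linear f .
  have commute: "c *\<^sub>C (r *\<^sub>R z) = r *\<^sub>R (c *\<^sub>C z)" for r and z :: 'b
    by (metis scaleC_of_real scaleC_scaleC mult.commute)
  show "bounded_linear (\<lambda>x. c *\<^sub>C f x)"
  proof (rule bounded_linear_intro[where K = "cmod c * onorm f"])
    show "norm (c *\<^sub>C f x) \<le> norm x * (cmod c * onorm f)" for x
      using mult_left_mono[OF onorm[OF \<open>bounded_linear f\<close>, of x], of "cmod c"]
      by (simp add: norm_scaleC algebra_simps)
  qed (simp_all add: add scaleR scaleC_add_right commute)
qed

instance
proof
  fix c d :: complex and r :: real and f g :: "'a \<Rightarrow>\<^sub>L 'b"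
  show "c *\<^sub>C (f + g) = c *\<^sub>C f + c *\<^sub>C g"
    by transfer (simp add: scaleC_add_right)
  show "(c + d) *\<^sub>C f = c *\<^sub>C f + d *\<^sub>C f"
    by transfer (simp add: scaleC_add_left)
  show "c *\<^sub>C d *\<^sub>C f = (c * d) *\<^sub>C f"
    by transfer (simp add: scaleC_scaleC)
  show "of_real r *\<^sub>C f = r *\<^sub>R f"
    by transfer (simp add: scaleC_of_real)
  have le: "norm (c *\<^sub>C f) \<le> cmod c * norm f" for c and f :: "'a \<Rightarrow>\<^sub>L 'b"
    by (rule norm_blinfun_bound)
      (auto simp: scaleC_blinfun.rep_eq norm_scaleC mult.assoc intro!: mult_left_mono norm_blinfun)
  show "norm (c *\<^sub>C f) = cmod c * norm f"
  proof (cases "c = 0")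
    case True
    then show ?thesis using le[of c f] by simp
  next
    case False
    have "inverse c *\<^sub>C c *\<^sub>C f = f"
      using False by transfer (simp add: scaleC_scaleC scaleC_of_real[of 1, simplified])
    then have "norm f \<le> cmod (inverse c) * norm (c *\<^sub>C f)"
      using le[of "inverse c" "c *\<^sub>C f"] by simp
    then have "cmod c * norm f \<le> norm (c *\<^sub>C f)"
      using False by (simp add: norm_inverse norm_divide field_simps)
    with le[of c f] show ?thesis by simp
  qed
qed

end

text \<open>The library type \<open>'h \<Rightarrow>\<^sub>L 'h\<close> consists of the bounded real-linear maps; the bounded
  complex-linear operators \<open>B(\<H>)\<close> form the following subset.\<close>

definition bounded_ops :: "('a::complex_normed_vector \<Rightarrow>\<^sub>L 'a) set" where
  "bounded_ops = {T :: 'a \<Rightarrow>\<^sub>L 'a. \<forall>c x. T (c *\<^sub>C x) = c *\<^sub>C T x}"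

definition is_adjoint :: "('h::chilbert_space \<Rightarrow>\<^sub>L 'h) \<Rightarrow> ('h \<Rightarrow>\<^sub>L 'h) \<Rightarrow> bool" where
  "is_adjoint S T \<longleftrightarrow> (\<forall>x y. cinner (S x) y = cinner x (T y))"

definition projection :: "('h::chilbert_space \<Rightarrow>\<^sub>L 'h) \<Rightarrow> bool" where
  "projection p \<longleftrightarrow> p \<in> bounded_ops \<and> p o\<^sub>L p = p \<and> is_adjoint p p"

definition star_representation ::
    "('b::normed_star_algebra \<Rightarrow> ('h::chilbert_space \<Rightarrow>\<^sub>L 'h)) \<Rightarrow> bool" where
  "star_representation \<pi> \<longleftrightarrow>
     range \<pi> \<subseteq> bounded_ops \<and>
     (\<forall>a b. \<pi> (a + b) = \<pi> a + \<pi> b) \<and>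
     (\<forall>c a. \<pi> (c *\<^sub>C a) = c *\<^sub>C \<pi> a) \<and>
     (\<forall>a b. \<pi> (a * b) = \<pi> a o\<^sub>L \<pi> b) \<and>
     (\<forall>a. is_adjoint (\<pi> (star a)) (\<pi> a))"

text \<open>The vectors \<open>\<pi> a \<xi>\<close> are closed under complex scalars, so their real span is their
  complex span.\<close>

definition nondegenerate ::
    "('b::normed_star_algebra \<Rightarrow> ('h::chilbert_space \<Rightarrow>\<^sub>L 'h)) \<Rightarrow> bool" where
  "nondegenerate \<pi> \<longleftrightarrow> closure (span {\<pi> a \<xi> | a \<xi>. True}) = UNIV"


section \<open>Subalgebras, positivity, approximate units\<close>

definition cstar_subalgebra :: "'a::normed_star_algebra set \<Rightarrow> bool" where
  "cstar_subalgebra A \<longleftrightarrow>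
     0 \<in> A \<and> (\<forall>x\<in>A. \<forall>y\<in>A. x + y \<in> A \<and> x * y \<in> A) \<and>
     (\<forall>c. \<forall>x\<in>A. c *\<^sub>C x \<in> A) \<and> (\<forall>x\<in>A. star x \<in> A) \<and> closed A"

text \<open>The positive elements of a C*-algebra \<open>A\<close> are those of the form \<open>c\<^sup>* c\<close> with \<open>c \<in> A\<close>.\<close>

definition positive_elements :: "'a::normed_star_algebra set \<Rightarrow> 'a set" where
  "positive_elements A = {star c * c | c. c \<in> A}"

definition hereditary_cstar_subalgebra :: "'a::normed_star_algebra set \<Rightarrow> bool" where
  "hereditary_cstar_subalgebra H \<longleftrightarrow>
     cstar_subalgebra H \<and>
     (\<forall>a b. a \<in> positive_elements UNIV \<longrightarrow> b - a \<in> positive_elements UNIV \<longrightarrow> b \<in> H \<longrightarrow> a \<in> H)"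

text \<open>An approximate unit consists of positive contractions; it is not required to be increasing.\<close>

definition sigma_unital :: "'a::normed_star_algebra set \<Rightarrow> bool" where
  "sigma_unital A \<longleftrightarrow>
     (\<exists>e :: nat \<Rightarrow> 'a.
        (\<forall>n. e n \<in> positive_elements A \<and> norm (e n) \<le> 1) \<and>
        (\<forall>a\<in>A. (\<lambda>n. e n * a) \<longlonglongrightarrow> a \<and> (\<lambda>n. a * e n) \<longlonglongrightarrow> a))"


section \<open>The multiplier algebra\<close>

text \<open>Multipliers are double centralizers \<open>(L, R)\<close>; an element \<open>d\<close> of the algebra corresponds to
  left and right multiplication by \<open>d\<close>.\<close>

typedef (overloaded) ('a::cstar_algebra) multiplier =
  "{(L :: 'a \<Rightarrow>\<^sub>L 'a, R :: 'a \<Rightarrow>\<^sub>L 'a).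
      L \<in> bounded_ops \<and> R \<in> bounded_ops \<and>
      (\<forall>a b. L (a * b) = L a * b) \<and> (\<forall>a b. R (a * b) = a * R b) \<and>
      (\<forall>a b. R a * b = a * L b)}"
  by (rule exI[of _ "(0, 0)"]) (simp add: bounded_ops_def scaleC_zero_right)

setup_lifting type_definition_multiplier

lemma bounded_ops_scaleC: "T \<in> bounded_ops \<Longrightarrow> T (c *\<^sub>C x) = c *\<^sub>C T x"
  by (simp add: bounded_ops_def)

definition left_mult :: "'a::cstar_algebra multiplier \<Rightarrow> 'a \<Rightarrow>\<^sub>L 'a" where
  "left_mult m = fst (Rep_multiplier m)"

definition right_mult :: "'a::cstar_algebra multiplier \<Rightarrow> 'a \<Rightarrow>\<^sub>L 'a" where
  "right_mult m = snd (Rep_multiplier m)"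

lemma
  shows left_mult_scaleC: "left_mult m (c *\<^sub>C a) = c *\<^sub>C left_mult m a"
    and right_mult_scaleC: "right_mult m (c *\<^sub>C a) = c *\<^sub>C right_mult m a"
    and left_mult_mult: "left_mult m (a * b) = left_mult m a * b"
    and right_mult_mult: "right_mult m (a * b) = a * right_mult m b"
    and right_mult_left_mult: "right_mult m a * b = a * left_mult m b"
  using Rep_multiplier[of m]
  by (auto simp: left_mult_def right_mult_def bounded_ops_scaleC split: prod.splits)

lemma multiplier_eqI:
  "left_mult m = left_mult n \<Longrightarrow> right_mult m = right_mult n \<Longrightarrow> m = n"
  by (simp add: left_mult_def right_mult_def prod_eq_iff flip: Rep_multiplier_inject)

lift_definition star_conj :: "('a::normed_star_algebra \<Rightarrow>\<^sub>L 'a) \<Rightarrow> 'a \<Rightarrow>\<^sub>L 'a"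
  is "\<lambda>T a. star (T (star a))"
proof -
  fix T :: "'a \<Rightarrow> 'a"
  assume "bounded_linear T"
  then interpret bounded_linear T .
  show "bounded_linear (\<lambda>a. star (T (star a)))"
  proof (rule bounded_linear_intro[where K = "onorm T"])
    show "norm (star (T (star a))) \<le> norm a * onorm T" for a
      using onorm[OF \<open>bounded_linear T\<close>, of "star a"] by (simp add: norm_star mult.commute)
  qed (simp_all add: star_add star_scaleR add scaleR)
qed

lemma norm_star_conj_le: "norm (star_conj T) \<le> norm T"
  by (rule norm_blinfun_bound)
    (auto simp: star_conj.rep_eq norm_star intro: order_trans[OF norm_blinfun])

lemma star_conj_centralizer:
  fixes L R :: "'a::normed_star_algebra \<Rightarrow>\<^sub>L 'a"
  assumes "\<forall>a b. R a * b = a * L b"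
  shows "star (L (star a)) * b = a * star (R (star b))"
proof -
  have "star (R (star b) * star a) = star (star b * L (star a))"
    using assms by simp
  then show ?thesis by (simp add: star_mult star_star)
qed

instantiation multiplier :: (cstar_algebra) normed_star_algebra
begin

lift_definition zero_multiplier :: "'a multiplier" is "(0, 0)"
  by (simp add: bounded_ops_def scaleC_zero_right)

lift_definition plus_multiplier :: "'a multiplier \<Rightarrow> 'a multiplier \<Rightarrow> 'a multiplier"
  is "\<lambda>(L, R) (L', R'). (L + L', R + R')"
  by (auto simp: bounded_ops_def blinfun.add_left scaleC_add_right distrib_left distrib_right)

lift_definition uminus_multiplier :: "'a multiplier \<Rightarrow> 'a multiplier"
  is "\<lambda>(L, R). (- L, - R)"
  by (auto simp: bounded_ops_def blinfun.minus_left scaleC_minus_right)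

lift_definition minus_multiplier :: "'a multiplier \<Rightarrow> 'a multiplier \<Rightarrow> 'a multiplier"
  is "\<lambda>(L, R) (L', R'). (L - L', R - R')"
  by (auto simp: bounded_ops_def blinfun.diff_left scaleC_diff_right left_diff_distrib right_diff_distrib)

lift_definition times_multiplier :: "'a multiplier \<Rightarrow> 'a multiplier \<Rightarrow> 'a multiplier"
  is "\<lambda>(L, R) (L', R'). (L o\<^sub>L L', R' o\<^sub>L R)"
  by (auto simp: bounded_ops_def)

lift_definition scaleC_multiplier :: "complex \<Rightarrow> 'a multiplier \<Rightarrow> 'a multiplier"
  is "\<lambda>c (L, R). (c *\<^sub>C L, c *\<^sub>C R)"
  by (auto simp: bounded_ops_def scaleC_blinfun.rep_eq mult_scaleC_left mult_scaleC_right
      scaleC_scaleC mult.commute)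

definition scaleR_multiplier :: "real \<Rightarrow> 'a multiplier \<Rightarrow> 'a multiplier" where
  "scaleR_multiplier r m = of_real r *\<^sub>C m"

lift_definition star_multiplier :: "'a multiplier \<Rightarrow> 'a multiplier"
  is "\<lambda>(L, R). (star_conj R, star_conj L)"
  by (auto simp: bounded_ops_def star_conj.rep_eq star_scaleC star_mult star_star
      intro: star_conj_centralizer)

text \<open>Using \<open>R\<close> instead of \<open>L\<close> gives the same norm, see \<open>norm_right_mult\<close> below.\<close>

definition norm_multiplier :: "'a multiplier \<Rightarrow> real" where
  "norm_multiplier m = norm (left_mult m)"

definition dist_multiplier :: "'a multiplier \<Rightarrow> 'a multiplier \<Rightarrow> real" where
  "dist_multiplier m n = norm (m - n)"

definition [code del]:
  "(uniformity :: ('a multiplier \<times> 'a multiplier) filter) =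
     (INF e\<in>{0 <..}. principal {(x, y). dist x y < e})"

definition open_multiplier :: "'a multiplier set \<Rightarrow> bool" where
  [code del]: "open_multiplier S = (\<forall>x\<in>S. \<forall>\<^sub>F (x', y) in uniformity. x' = x \<longrightarrow> y \<in> S)"

definition sgn_multiplier :: "'a multiplier \<Rightarrow> 'a multiplier" where
  "sgn_multiplier m = inverse (norm m) *\<^sub>R m"

lemma
  shows left_mult_zero: "left_mult (0::'a multiplier) = 0"
    and right_mult_zero: "right_mult (0::'a multiplier) = 0"
  by (simp_all add: left_mult_def right_mult_def zero_multiplier.rep_eq)

lemma
  fixes m n :: "'a multiplier"
  shows left_mult_plus: "left_mult (m + n) = left_mult m + left_mult n"
    and right_mult_plus: "right_mult (m + n) = right_mult m + right_mult n"
    and left_mult_minus: "left_mult (- m) = - left_mult m"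
    and right_mult_minus: "right_mult (- m) = - right_mult m"
    and left_mult_diff: "left_mult (m - n) = left_mult m - left_mult n"
    and right_mult_diff: "right_mult (m - n) = right_mult m - right_mult n"
    and left_mult_times: "left_mult (m * n) = left_mult m o\<^sub>L left_mult n"
    and right_mult_times: "right_mult (m * n) = right_mult n o\<^sub>L right_mult m"
    and left_mult_scaleC_left: "left_mult (c *\<^sub>C m) = c *\<^sub>C left_mult m"
    and right_mult_scaleC_left: "right_mult (c *\<^sub>C m) = c *\<^sub>C right_mult m"
    and left_mult_star: "left_mult (star m) = star_conj (right_mult m)"
    and right_mult_star: "right_mult (star m) = star_conj (left_mult m)"
  by (simp_all add: left_mult_def right_mult_def plus_multiplier.rep_eq uminus_multiplier.rep_eq
      minus_multiplier.rep_eq times_multiplier.rep_eq scaleC_multiplier.rep_eq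
      star_multiplier.rep_eq split: prod.split)

lemmas multiplier_simps = left_mult_zero right_mult_zero left_mult_plus right_mult_plus
  left_mult_minus right_mult_minus left_mult_diff right_mult_diff left_mult_times right_mult_times
  left_mult_scaleC_left right_mult_scaleC_left left_mult_star right_mult_star

lemma norm_left_mult_le: "norm (left_mult m) \<le> norm (right_mult m)"
  for m :: "'a multiplier"
proof (rule norm_blinfun_bound)
  fix b :: 'a
  let ?x = "left_mult m b"
  have "norm ?x * norm ?x = norm (star ?x * ?x)"
    by (simp add: cstar_identity power2_eq_square)
  also have "\<dots> = norm (right_mult m (star ?x) * b)"
    by (simp add: right_mult_left_mult)
  also have "\<dots> \<le> norm (right_mult m (star ?x)) * norm b"
    by (rule norm_mult_ineq)
  also have "\<dots> \<le> norm (right_mult m) * norm ?x * norm b"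
    using norm_blinfun[of "right_mult m" "star ?x"] by (simp add: norm_star mult_right_mono)
  finally have "norm ?x * norm ?x \<le> (norm (right_mult m) * norm b) * norm ?x"
    by (simp add: algebra_simps)
  then show "norm ?x \<le> norm (right_mult m) * norm b"
    by (cases "norm ?x = 0") (auto simp: mult_le_cancel_right)
qed simp

lemma norm_right_mult_le: "norm (right_mult m) \<le> norm (left_mult m)"
  for m :: "'a multiplier"
proof (rule norm_blinfun_bound)
  fix b :: 'a
  let ?x = "right_mult m b"
  have "norm ?x * norm ?x = norm (?x * star ?x)"
    using cstar_identity[of "star ?x"] by (simp add: star_star norm_star power2_eq_square)
  also have "\<dots> = norm (b * left_mult m (star ?x))"
    by (simp add: right_mult_left_mult)
  also have "\<dots> \<le> norm b * norm (left_mult m (star ?x))"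
    by (rule norm_mult_ineq)
  also have "\<dots> \<le> norm b * (norm (left_mult m) * norm ?x)"
    using norm_blinfun[of "left_mult m" "star ?x"] by (simp add: norm_star mult_left_mono)
  finally have "norm ?x * norm ?x \<le> (norm (left_mult m) * norm b) * norm ?x"
    by (simp add: algebra_simps)
  then show "norm ?x \<le> norm (left_mult m) * norm b"
    by (cases "norm ?x = 0") (auto simp: mult_le_cancel_right)
qed simp

lemma norm_right_mult: "norm (right_mult m) = norm m"
  for m :: "'a multiplier"
  using norm_left_mult_le[of m] norm_right_mult_le[of m] by (simp add: norm_multiplier_def)

instance
proof
  fix m n k :: "'a multiplier" and c d :: complex and r s :: real
  show "m + n + k = m + (n + k)" "m + n = n + m" "0 + m = m" "- m + m = 0" "m - n = m + - n"
    by (rule multiplier_eqI; simp add: multiplier_simps algebra_simps)+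
  show "m * n * k = m * (n * k)" "(m + n) * k = m * k + n * k" "m * (n + k) = m * n + m * k"
    by (rule multiplier_eqI; rule blinfun_eqI;
        simp add: multiplier_simps blinfun.add_left blinfun.add_right)+
  show C: "c *\<^sub>C (m + n) = c *\<^sub>C m + c *\<^sub>C n" "(c + d) *\<^sub>C m = c *\<^sub>C m + d *\<^sub>C m"
      "c *\<^sub>C d *\<^sub>C m = (c * d) *\<^sub>C m"
    by (rule multiplier_eqI; simp add: multiplier_simps scaleC_add_right scaleC_add_left scaleC_scaleC)+
  show R: "of_real r *\<^sub>C m = r *\<^sub>R m" by (simp add: scaleR_multiplier_def)
  show "r *\<^sub>R (m + n) = r *\<^sub>R m + r *\<^sub>R n" "(r + s) *\<^sub>R m = r *\<^sub>R m + s *\<^sub>R m"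
      "r *\<^sub>R s *\<^sub>R m = (r * s) *\<^sub>R m" "1 *\<^sub>R m = m"
    by (rule multiplier_eqI; simp add: multiplier_simps scaleR_multiplier_def scaleC_one
        scaleC_add_right scaleC_add_left scaleC_scaleC)+
  show "(r *\<^sub>R m) * n = r *\<^sub>R (m * n)" "m * (r *\<^sub>R n) = r *\<^sub>R (m * n)"
    by (rule multiplier_eqI; rule blinfun_eqI; simp add: multiplier_simps scaleR_multiplier_def
        scaleC_blinfun.rep_eq left_mult_scaleC right_mult_scaleC)+
  show "(c *\<^sub>C m) * n = c *\<^sub>C (m * n)" "m * (c *\<^sub>C n) = c *\<^sub>C (m * n)"
    by (rule multiplier_eqI; rule blinfun_eqI; simp add: multiplier_simps
        scaleC_blinfun.rep_eq left_mult_scaleC right_mult_scaleC)+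
  show "star (star m) = m"
    by (rule multiplier_eqI; rule blinfun_eqI; simp add: multiplier_simps star_conj.rep_eq star_star)
  show "star (m + n) = star m + star n"
    by (rule multiplier_eqI; rule blinfun_eqI;
        simp add: multiplier_simps star_conj.rep_eq blinfun.add_left star_add)
  show "star (c *\<^sub>C m) = cnj c *\<^sub>C star m"
    by (rule multiplier_eqI; rule blinfun_eqI;
        simp add: multiplier_simps star_conj.rep_eq scaleC_blinfun.rep_eq star_scaleC)
  show "star (m * n) = star n * star m"
    by (rule multiplier_eqI; rule blinfun_eqI; simp add: multiplier_simps star_conj.rep_eq star_star)
  show "norm (star m) = norm m"
  proof (rule antisym)
    have le: "norm (star m) \<le> norm m" for m :: "'a multiplier"
      using norm_star_conj_le[of "right_mult m"] norm_right_mult[of m]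
      by (simp add: norm_multiplier_def left_mult_star)
    show "norm (star m) \<le> norm m" by (rule le)
    show "norm m \<le> norm (star m)" using le[of "star m"] \<open>star (star m) = m\<close> by simp
  qed
  show "dist m n = norm (m - n)" by (simp add: dist_multiplier_def)
  show "sgn m = inverse (norm m) *\<^sub>R m" by (simp add: sgn_multiplier_def)
  show "(uniformity :: ('a multiplier \<times> 'a multiplier) filter) =
      (INF e\<in>{0 <..}. principal {(x, y). dist x y < e})"
    by (rule uniformity_multiplier_def)
  show "open U = (\<forall>x\<in>U. \<forall>\<^sub>F (x', y) in uniformity. x' = x \<longrightarrow> y \<in> U)"
    for U :: "'a multiplier set"
    by (rule open_multiplier_def)
  show "norm m = 0 \<longleftrightarrow> m = 0"
  proof
    assume "norm m = 0"
    then have "left_mult m = 0" "right_mult m = 0"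
      using norm_right_mult[of m] by (simp_all add: norm_multiplier_def)
    then show "m = 0" by (auto intro: multiplier_eqI simp: multiplier_simps)
  qed (simp add: norm_multiplier_def multiplier_simps)
  show "norm (m + n) \<le> norm m + norm n"
    by (simp add: norm_multiplier_def multiplier_simps norm_triangle_ineq)
  show "norm (c *\<^sub>C m) = cmod c * norm m"
    by (simp add: norm_multiplier_def multiplier_simps norm_scaleC)
  show "norm (r *\<^sub>R m) = \<bar>r\<bar> * norm m"
    by (simp add: norm_multiplier_def scaleR_multiplier_def multiplier_simps norm_scaleC)
  show "norm (m * n) \<le> norm m * norm n"
    by (simp add: norm_multiplier_def multiplier_simps norm_blinfun_compose)
qed

end

instance multiplier :: (cstar_algebra) cstar_algebra
proof
  fix m :: "'a multiplier"
  have "norm (left_mult m) \<le> sqrt (norm (star m * m))"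
  proof (rule norm_blinfun_bound)
    fix b :: 'a
    let ?x = "left_mult m b"
    have star_x: "star ?x = right_mult (star m) (star b)"
      by (simp add: right_mult_star star_conj.rep_eq star_star)
    have "(norm ?x)\<^sup>2 = norm (star ?x * ?x)"
      by (simp add: cstar_identity)
    also have "star ?x * ?x = star b * left_mult (star m * m) b"
      unfolding star_x right_mult_left_mult by (simp add: left_mult_times)
    also have "norm \<dots> \<le> norm b * norm (left_mult (star m * m) b)"
      using norm_mult_ineq[of "star b"] by (simp add: norm_star)
    also have "\<dots> \<le> norm b * (norm (star m * m) * norm b)"
      using norm_blinfun[of "left_mult (star m * m)" b]
      by (simp add: norm_multiplier_def mult_left_mono)
    also have "\<dots> = (sqrt (norm (star m * m)) * norm b)\<^sup>2"
      by (simp add: power_mult_distrib power2_eq_square)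
    finally show "norm ?x \<le> sqrt (norm (star m * m)) * norm b"
      by (rule power2_le_imp_le) simp
  qed simp
  then have "norm m \<le> sqrt (norm (star m * m))"
    by (simp add: norm_multiplier_def[of m])
  from power_mono[OF this, of 2] have "(norm m)\<^sup>2 \<le> norm (star m * m)"
    by simp
  moreover have "norm (star m * m) \<le> (norm m)\<^sup>2"
    using norm_mult_ineq[of "star m" m] by (simp add: norm_star power2_eq_square)
  ultimately show "norm (star m * m) = (norm m)\<^sup>2" by simp
next
  fix X :: "nat \<Rightarrow> 'a multiplier"
  assume X: "Cauchy X"
  have "Cauchy (\<lambda>n. left_mult (X n))" "Cauchy (\<lambda>n. right_mult (X n))"
    using X unfolding Cauchy_def dist_norm
    by (simp_all add: norm_right_mult flip: left_mult_diff right_mult_diff norm_multiplier_def)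
  then obtain L R where L: "(\<lambda>n. left_mult (X n)) \<longlonglongrightarrow> L" and R: "(\<lambda>n. right_mult (X n)) \<longlonglongrightarrow> R"
    using Cauchy_convergent_iff convergent_def by metis
  have La: "(\<lambda>n. left_mult (X n) a) \<longlonglongrightarrow> L a" and Ra: "(\<lambda>n. right_mult (X n) a) \<longlonglongrightarrow> R a" for a
    using L R by (auto intro!: tendsto_eq_intros)
  have C: "(\<lambda>n. c *\<^sub>C f n) \<longlonglongrightarrow> c *\<^sub>C l" if "f \<longlonglongrightarrow> l" for c and f :: "nat \<Rightarrow> 'a" and l
  proof -
    have "bounded_linear ((*\<^sub>C) c :: 'a \<Rightarrow> 'a)"
      by (rule bounded_linear_intro[where K = "cmod c"])
        (simp_all add: scaleC_add_right scaleC_scaleR norm_scaleC)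
    then show ?thesis using that by (rule bounded_linear.tendsto)
  qed
  have "L (c *\<^sub>C a) = c *\<^sub>C L a" "R (c *\<^sub>C a) = c *\<^sub>C R a" for c a
    using LIMSEQ_unique[OF La[of "c *\<^sub>C a"]] LIMSEQ_unique[OF Ra[of "c *\<^sub>C a"]]
      C[OF La[of a]] C[OF Ra[of a]]
    by (simp_all add: left_mult_scaleC right_mult_scaleC)
  moreover have "L (a * b) = L a * b" for a b
    using LIMSEQ_unique[OF La[of "a * b"]] tendsto_mult_right[OF La[of a], of b]
    by (simp add: left_mult_mult)
  moreover have "R (a * b) = a * R b" for a b
    using LIMSEQ_unique[OF Ra[of "a * b"]] tendsto_mult_left[OF Ra[of b], of a]
    by (simp add: right_mult_mult)
  moreover have "R a * b = a * L b" for a b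
    using LIMSEQ_unique[OF tendsto_mult_right[OF Ra[of a], of b]] tendsto_mult_left[OF La[of b], of a]
    by (simp add: right_mult_left_mult)
  ultimately have LR: "Rep_multiplier (Abs_multiplier (L, R)) = (L, R)"
    by (intro Abs_multiplier_inverse) (simp add: bounded_ops_def)
  have "norm (X n - Abs_multiplier (L, R)) = norm (left_mult (X n) - L)" for n
    using LR by (simp add: norm_multiplier_def left_mult_diff left_mult_def[of "Abs_multiplier _"])
  then have "(\<lambda>n. norm (X n - Abs_multiplier (L, R))) \<longlonglongrightarrow> 0"
    using tendsto_norm_zero[OF LIM_zero[OF L]] by simp
  then have "X \<longlonglongrightarrow> Abs_multiplier (L, R)"
    by (rule LIM_zero_cancel[OF tendsto_norm_zero_cancel])
  then show "convergent X" by (auto simp: convergent_def)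
qed

lift_definition of_algebra :: "'a::cstar_algebra \<Rightarrow> 'a multiplier"
  is "\<lambda>d. (blinfun_mult_right d, blinfun_mult_left d)"
  by (auto simp: bounded_ops_def mult_scaleC_left mult_scaleC_right mult.assoc)


section \<open>The corona algebra\<close>

lemma
  shows left_mult_of_algebra: "left_mult (of_algebra d) = blinfun_mult_right d"
    and right_mult_of_algebra: "right_mult (of_algebra d) = blinfun_mult_left d"
  by (simp_all add: left_mult_def right_mult_def of_algebra.rep_eq)

lemma of_algebra_add: "of_algebra (a + b) = of_algebra a + of_algebra b"
  by (rule multiplier_eqI; rule blinfun_eqI;
      simp add: left_mult_of_algebra right_mult_of_algebra multiplier_simps blinfun.add_left algebra_simps)

lemma of_algebra_scaleC: "of_algebra (c *\<^sub>C a) = c *\<^sub>C of_algebra a"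
  by (rule multiplier_eqI; rule blinfun_eqI;
      simp add: left_mult_of_algebra right_mult_of_algebra multiplier_simps scaleC_blinfun.rep_eq
        mult_scaleC_left mult_scaleC_right)

lemma of_algebra_star: "of_algebra (star a) = star (of_algebra a)"
  by (rule multiplier_eqI; rule blinfun_eqI;
      simp add: left_mult_of_algebra right_mult_of_algebra multiplier_simps star_conj.rep_eq
        star_mult star_star)

lemma mult_of_algebra: "m * of_algebra a = of_algebra (left_mult m a)"
  by (rule multiplier_eqI; rule blinfun_eqI;
      simp add: left_mult_of_algebra right_mult_of_algebra multiplier_simps left_mult_mult
        right_mult_left_mult)

lemma of_algebra_mult: "of_algebra a * m = of_algebra (right_mult m a)"
  by (rule multiplier_eqI; rule blinfun_eqI;
      simp add: left_mult_of_algebra right_mult_of_algebra multiplier_simps right_mult_mult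
        right_mult_left_mult)

lemma norm_of_algebra: "norm (of_algebra a) = norm a"
proof (rule antisym)
  show "norm (of_algebra a) \<le> norm a"
    unfolding norm_multiplier_def left_mult_of_algebra
    by (rule norm_blinfun_bound) (auto simp: norm_mult_ineq)
  have "norm a * norm a = norm (a * star a)"
    using cstar_identity[of "star a"] by (simp add: star_star norm_star power2_eq_square)
  also have "\<dots> \<le> norm (of_algebra a) * norm a"
    using norm_blinfun[of "left_mult (of_algebra a)" "star a"]
    by (simp add: norm_multiplier_def left_mult_of_algebra norm_star)
  finally show "norm a \<le> norm (of_algebra a)"
    by (cases "norm a = 0") (auto simp: mult_le_cancel_right)
qed

lemma bounded_linear_of_algebra: "bounded_linear of_algebra"
  by (rule bounded_linear_intro[where K = 1])
    (simp_all add: of_algebra_add of_algebra_scaleC norm_of_algebra flip: scaleC_of_real)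

abbreviation ideal_of_algebra :: "'a::cstar_algebra multiplier set" where
  "ideal_of_algebra \<equiv> range of_algebra"

lemma ideal_zero: "0 \<in> ideal_of_algebra"
  using linear_0[OF bounded_linear.linear[OF bounded_linear_of_algebra]]
  by (rule range_eqI[OF sym])

lemma ideal_add: "x \<in> ideal_of_algebra \<Longrightarrow> y \<in> ideal_of_algebra \<Longrightarrow> x + y \<in> ideal_of_algebra"
  by (auto simp flip: of_algebra_add)

lemma ideal_scaleC: "x \<in> ideal_of_algebra \<Longrightarrow> c *\<^sub>C x \<in> ideal_of_algebra"
  by (auto simp flip: of_algebra_scaleC)

lemma ideal_minus: "x \<in> ideal_of_algebra \<Longrightarrow> - x \<in> ideal_of_algebra"
  using ideal_scaleC[of x "of_real (- 1)"] unfolding scaleC_of_real by simp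

lemma ideal_diff: "x \<in> ideal_of_algebra \<Longrightarrow> y \<in> ideal_of_algebra \<Longrightarrow> x - y \<in> ideal_of_algebra"
  using ideal_add[of x "- y"] ideal_minus[of y] by simp

lemma ideal_star: "x \<in> ideal_of_algebra \<Longrightarrow> star x \<in> ideal_of_algebra"
  by (auto simp flip: of_algebra_star)

lemma ideal_mult_left: "x \<in> ideal_of_algebra \<Longrightarrow> m * x \<in> ideal_of_algebra"
  by (auto simp: mult_of_algebra)

lemma ideal_mult_right: "x \<in> ideal_of_algebra \<Longrightarrow> x * m \<in> ideal_of_algebra"
  by (auto simp: of_algebra_mult)

lemma closed_ideal: "closed (ideal_of_algebra :: 'a::cstar_algebra multiplier set)"
proof (rule complete_imp_closed, rule complete_isometric_image[where e = 1])
  show "complete (UNIV :: 'a set)" by (simp add: complete_UNIV)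
qed (simp_all add: bounded_linear_of_algebra norm_of_algebra)

text \<open>The quotient seminorm is the distance to the ideal.\<close>

lemma infdist_ideal_le: "x - y \<in> ideal_of_algebra \<Longrightarrow> infdist x ideal_of_algebra \<le> norm y"
  using infdist_le[of "x - y" ideal_of_algebra x] by (simp add: dist_norm)

lemma infdist_ideal_approx:
  fixes x :: "'a::cstar_algebra multiplier"
  assumes "e > 0"
  obtains y where "x - y \<in> ideal_of_algebra" "norm y < infdist x ideal_of_algebra + e"
proof -
  have "(INF a\<in>ideal_of_algebra. dist x a) < infdist x (ideal_of_algebra :: 'a multiplier set) + e"
    using assms ideal_zero by (auto simp: infdist_def)
  then obtain a where a: "a \<in> ideal_of_algebra" "dist x a < infdist x ideal_of_algebra + e"
    using cInf_lessD[of "dist x ` ideal_of_algebra"] by fastforce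
  show thesis
    by (rule that[of "x - a"]) (use a in \<open>auto simp: dist_norm\<close>)
qed

lemma infdist_ideal_cong:
  fixes x y :: "'a::cstar_algebra multiplier"
  assumes "x - y \<in> ideal_of_algebra"
  shows "infdist x ideal_of_algebra = infdist y ideal_of_algebra"
proof -
  have "infdist x ideal_of_algebra \<le> infdist y ideal_of_algebra"
    if xy: "x - y \<in> ideal_of_algebra" for x y :: "'a multiplier"
  proof (rule field_le_epsilon)
    fix e :: real
    assume "e > 0"
    then obtain z where z: "y - z \<in> ideal_of_algebra" "norm z < infdist y ideal_of_algebra + e"
      by (rule infdist_ideal_approx)
    have "x - z \<in> ideal_of_algebra" using ideal_add[OF xy z(1)] by simp
    from infdist_ideal_le[OF this] z(2)
    show "infdist x ideal_of_algebra \<le> infdist y ideal_of_algebra + e" by simp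
  qed
  from this[OF assms] this[of y x] ideal_minus[OF assms] show ?thesis by simp
qed

lemma infdist_ideal_eq_0_iff: "infdist x ideal_of_algebra = 0 \<longleftrightarrow> x \<in> ideal_of_algebra"
  using in_closed_iff_infdist_zero[OF closed_ideal, of x] ideal_zero by blast

quotient_type (overloaded) 'a corona =
  "'a::cstar_algebra multiplier" / "\<lambda>x y :: 'a::cstar_algebra multiplier. x - y \<in> ideal_of_algebra"
proof (rule equivpI)
  show "reflp (\<lambda>x y :: 'a multiplier. x - y \<in> ideal_of_algebra)"
    by (auto intro: reflpI simp: ideal_zero)
  show "symp (\<lambda>x y :: 'a multiplier. x - y \<in> ideal_of_algebra)"
    by (rule sympI, drule ideal_minus) simp
  show "transp (\<lambda>x y :: 'a multiplier. x - y \<in> ideal_of_algebra)"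
    by (rule transpI, drule (1) ideal_add) simp
qed

instantiation corona :: (cstar_algebra) normed_star_algebra
begin

lift_definition zero_corona :: "'a corona" is 0 .

lift_definition plus_corona :: "'a corona \<Rightarrow> 'a corona \<Rightarrow> 'a corona" is "(+)"
  by (drule (1) ideal_add) (simp add: algebra_simps)

lift_definition uminus_corona :: "'a corona \<Rightarrow> 'a corona" is uminus
  by (drule ideal_minus) simp

lift_definition minus_corona :: "'a corona \<Rightarrow> 'a corona \<Rightarrow> 'a corona" is "(-)"
proof -
  fix x x' y y' :: "'a multiplier"
  assume "x - x' \<in> ideal_of_algebra" "y - y' \<in> ideal_of_algebra"
  from ideal_diff[OF this] show "x - y - (x' - y') \<in> ideal_of_algebra"
    by (simp add: algebra_simps)
qed

lift_definition times_corona :: "'a corona \<Rightarrow> 'a corona \<Rightarrow> 'a corona" is "(*)"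
proof -
  fix x x' y y' :: "'a multiplier"
  assume "x - x' \<in> ideal_of_algebra" "y - y' \<in> ideal_of_algebra"
  from ideal_add[OF ideal_mult_right[OF this(1), of y] ideal_mult_left[OF this(2), of x']]
  show "x * y - x' * y' \<in> ideal_of_algebra"
    by (simp add: algebra_simps)
qed

lift_definition scaleC_corona :: "complex \<Rightarrow> 'a corona \<Rightarrow> 'a corona" is "(*\<^sub>C)"
  by (simp add: ideal_scaleC flip: scaleC_diff_right)

lift_definition scaleR_corona :: "real \<Rightarrow> 'a corona \<Rightarrow> 'a corona" is "(*\<^sub>R)"
  by (simp add: ideal_scaleC flip: scaleC_of_real scaleC_diff_right)

lift_definition star_corona :: "'a corona \<Rightarrow> 'a corona" is star
  by (simp add: ideal_star flip: star_diff)

lift_definition norm_corona :: "'a corona \<Rightarrow> real" is "\<lambda>x. infdist x ideal_of_algebra"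
  by (rule infdist_ideal_cong)

definition dist_corona :: "'a corona \<Rightarrow> 'a corona \<Rightarrow> real" where
  "dist_corona x y = norm (x - y)"

definition [code del]:
  "(uniformity :: ('a corona \<times> 'a corona) filter) =
     (INF e\<in>{0 <..}. principal {(x, y). dist x y < e})"

definition open_corona :: "'a corona set \<Rightarrow> bool" where
  [code del]: "open_corona S = (\<forall>x\<in>S. \<forall>\<^sub>F (x', y) in uniformity. x' = x \<longrightarrow> y \<in> S)"

definition sgn_corona :: "'a corona \<Rightarrow> 'a corona" where
  "sgn_corona x = inverse (norm x) *\<^sub>R x"

lemma norm_abs_corona_le: "norm (abs_corona m) \<le> norm m"
  by (simp add: norm_corona.abs_eq infdist_ideal_le ideal_zero)

lemma corona_approx:
  fixes x :: "'a corona"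
  assumes "e > 0"
  obtains m where "x = abs_corona m" "norm m < norm x + e"
proof -
  obtain k where k: "x = abs_corona k" using Quotient3_abs_rep[OF Quotient3_corona, of x, symmetric] by blast
  obtain m where m: "k - m \<in> ideal_of_algebra" "norm m < infdist k ideal_of_algebra + e"
    using infdist_ideal_approx[OF assms] by blast
  show thesis
  proof (rule that)
    show "x = abs_corona m" using k m(1) by (simp add: corona.abs_eq_iff)
    show "norm m < norm x + e" using m(2) k by (simp add: norm_corona.abs_eq)
  qed
qed

lemma norm_scaleC_corona_le: "norm (c *\<^sub>C x) \<le> cmod c * norm x" for x :: "'a corona"
proof (rule tendsto_le[OF _ _ tendsto_const, of "at_right (0::real)"])
  show "((\<lambda>e. cmod c * (norm x + e)) \<longlongrightarrow> cmod c * norm x) (at_right 0)"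
    by (auto intro!: tendsto_eq_intros)
  show "\<forall>\<^sub>F e in at_right 0. norm (c *\<^sub>C x) \<le> cmod c * (norm x + e)"
  proof (rule eventually_at_right_less[THEN eventually_mono])
    fix e :: real
    assume "0 < e"
    then obtain m where m: "x = abs_corona m" "norm m < norm x + e" by (rule corona_approx)
    have "norm (c *\<^sub>C x) \<le> cmod c * norm m"
      using norm_abs_corona_le[of "c *\<^sub>C m"] m(1) by (simp add: scaleC_corona.abs_eq norm_scaleC)
    also have "\<dots> \<le> cmod c * (norm x + e)"
      using m(2) by (simp add: mult_left_mono)
    finally show "norm (c *\<^sub>C x) \<le> cmod c * (norm x + e)" .
  qed
qed simp

lemma norm_mult_corona_le: "norm (x * y) \<le> norm x * norm y" for x y :: "'a corona"
proof (rule tendsto_le[OF _ _ tendsto_const, of "at_right (0::real)"])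
  show "((\<lambda>e. (norm x + e) * (norm y + e)) \<longlongrightarrow> norm x * norm y) (at_right 0)"
    by (auto intro!: tendsto_eq_intros)
  show "\<forall>\<^sub>F e in at_right 0. norm (x * y) \<le> (norm x + e) * (norm y + e)"
  proof (rule eventually_at_right_less[THEN eventually_mono])
    fix e :: real
    assume "0 < e"
    obtain m where m: "x = abs_corona m" "norm m < norm x + e"
      using corona_approx[OF \<open>0 < e\<close>] .
    obtain n where n: "y = abs_corona n" "norm n < norm y + e"
      using corona_approx[OF \<open>0 < e\<close>] .
    have "norm (x * y) \<le> norm (m * n)"
      using norm_abs_corona_le[of "m * n"] m(1) n(1) by (simp add: times_corona.abs_eq)
    also have "\<dots> \<le> norm m * norm n" by (rule norm_mult_ineq)
    also have "\<dots> \<le> (norm x + e) * (norm y + e)"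
      using m(2) n(2) by (intro mult_mono) (auto intro: order_trans[OF norm_ge_zero less_imp_le])
    finally show "norm (x * y) \<le> (norm x + e) * (norm y + e)" .
  qed
qed simp

lemma norm_plus_corona_le: "norm (x + y) \<le> norm x + norm y" for x y :: "'a corona"
proof (rule field_le_epsilon)
  fix e :: real
  assume "0 < e"
  then have e: "0 < e / 2" by simp
  obtain m where m: "x = abs_corona m" "norm m < norm x + e / 2"
    using corona_approx[OF e] .
  obtain n where n: "y = abs_corona n" "norm n < norm y + e / 2"
    using corona_approx[OF e] .
  have "norm (x + y) \<le> norm (m + n)"
    using norm_abs_corona_le[of "m + n"] m(1) n(1) by (simp add: plus_corona.abs_eq)
  also have "\<dots> \<le> norm m + norm n" by (rule norm_triangle_ineq)
  finally show "norm (x + y) \<le> norm x + norm y + e" using m(2) n(2) by simp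
qed

lemma norm_star_corona_le: "norm (star x) \<le> norm x" for x :: "'a corona"
proof (rule field_le_epsilon)
  fix e :: real
  assume "0 < e"
  then obtain m where m: "x = abs_corona m" "norm m < norm x + e" by (rule corona_approx)
  then show "norm (star x) \<le> norm x + e"
    using norm_abs_corona_le[of "star m"] by (simp add: star_corona.abs_eq norm_star)
qed

instance
proof
  fix x y z :: "'a corona" and c d :: complex and r s :: real
  note refl = ideal_zero[folded diff_self]
  show "x + y + z = x + (y + z)" "x + y = y + x" "0 + x = x" "- x + x = 0" "x - y = x + - y"
    by (transfer; simp add: algebra_simps ideal_zero)+
  show "x * y * z = x * (y * z)" "(x + y) * z = x * z + y * z" "x * (y + z) = x * y + x * z"
    by (transfer; simp add: algebra_simps ideal_zero)+
  show "c *\<^sub>C (x + y) = c *\<^sub>C x + c *\<^sub>C y"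
    by transfer (simp add: scaleC_add_right ideal_zero)
  show "(c + d) *\<^sub>C x = c *\<^sub>C x + d *\<^sub>C x"
    by transfer (simp add: scaleC_add_left ideal_zero)
  show CC: "c *\<^sub>C d *\<^sub>C x = (c * d) *\<^sub>C x" for c d and x :: "'a corona"
    by transfer (simp add: scaleC_scaleC ideal_zero)
  show CR: "of_real r *\<^sub>C x = r *\<^sub>R x" for r and x :: "'a corona"
    by transfer (simp add: scaleC_of_real ideal_zero)
  show "r *\<^sub>R (x + y) = r *\<^sub>R x + r *\<^sub>R y" "(r + s) *\<^sub>R x = r *\<^sub>R x + s *\<^sub>R x"
      "r *\<^sub>R s *\<^sub>R x = (r * s) *\<^sub>R x" and R1: "1 *\<^sub>R x = x" for x y :: "'a corona"
    by (transfer; simp add: algebra_simps ideal_zero)+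
  show "(r *\<^sub>R x) * y = r *\<^sub>R (x * y)" "x * (r *\<^sub>R y) = r *\<^sub>R (x * y)"
    by (transfer; simp add: ideal_zero)+
  show "(c *\<^sub>C x) * y = c *\<^sub>C (x * y)" "x * (c *\<^sub>C y) = c *\<^sub>C (x * y)"
    by (transfer; simp add: mult_scaleC_left mult_scaleC_right ideal_zero)+
  show SS: "star (star x) = x" for x :: "'a corona"
    by transfer (simp add: star_star ideal_zero)
  show "star (x + y) = star x + star y"
    by transfer (simp add: star_add ideal_zero)
  show "star (c *\<^sub>C x) = cnj c *\<^sub>C star x"
    by transfer (simp add: star_scaleC ideal_zero)
  show "star (x * y) = star y * star x"
    by transfer (simp add: star_mult ideal_zero)
  show "norm (star x) = norm x"
    using norm_star_corona_le[of x] norm_star_corona_le[of "star x"] by (simp add: SS)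
  show "dist x y = norm (x - y)" by (simp add: dist_corona_def)
  show "sgn x = inverse (norm x) *\<^sub>R x" by (simp add: sgn_corona_def)
  show "(uniformity :: ('a corona \<times> 'a corona) filter) =
      (INF e\<in>{0 <..}. principal {(x, y). dist x y < e})"
    by (rule uniformity_corona_def)
  show "open U = (\<forall>x\<in>U. \<forall>\<^sub>F (x', y) in uniformity. x' = x \<longrightarrow> y \<in> U)"
    for U :: "'a corona set"
    by (rule open_corona_def)
  show N0: "norm x = 0 \<longleftrightarrow> x = 0" for x :: "'a corona"
    by transfer (simp add: infdist_ideal_eq_0_iff)
  show "norm (x + y) \<le> norm x + norm y" by (rule norm_plus_corona_le)
  show "norm (x * y) \<le> norm x * norm y" by (rule norm_mult_corona_le)
  show NC: "norm (c *\<^sub>C x) = cmod c * norm x" for c and x :: "'a corona"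
  proof (cases "c = 0")
    case True
    have "0 \<le> norm x" by transfer (rule infdist_nonneg)
    have "0 *\<^sub>C x = 0" by transfer (simp add: scaleC_zero_left ideal_zero)
    then show ?thesis using True N0 by simp
  next
    case False
    have "inverse c *\<^sub>C c *\<^sub>C x = x"
      using False CR[of 1 x] by (simp add: CC R1)
    then have "norm x \<le> cmod (inverse c) * norm (c *\<^sub>C x)"
      using norm_scaleC_corona_le[of "inverse c" "c *\<^sub>C x"] by simp
    then have "cmod c * norm x \<le> norm (c *\<^sub>C x)"
      using False by (simp add: norm_inverse norm_divide field_simps)
    with norm_scaleC_corona_le[of c x] show ?thesis by simp
  qed
  show "norm (r *\<^sub>R x) = \<bar>r\<bar> * norm x"
    using NC[of "of_real r" x] by (simp add: CR)
qed

end

end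

(* The projection p is the one onto the closure K of the span of H \<H>, and H is contained in
   p B(\<H>) p. Conversely let b = p b p lie in B and let e_n be a sequential approximate unit of H. If
   e_n b did not converge to b, there would be x in B with x e_n = 0 for all n but x b \<noteq> 0 (this
   uses that B is the corona of a \<sigma>-unital algebra); then x vanishes on K, so x b = x p b = 0, a
   contradiction. Applying this to b and its adjoint gives b = lim e_n b e_n, which lies in H because
   H B H \<subseteq> H.

   The annihilator x is represented by a strictly convergent sum of elements z_j g_j of D, where g_j
   lifts (1 - e_n)/6 for a suitable n depending on j and z_j = (1 - d_M) d_N with d_n an approximate
   unit of D and M, N chosen so large that the terms are nearly orthogonal to each other. *)

theory Submission
  imports Defs
begin

section \<open>Orthogonal projections\<close>

text \<open>The corner p B(H) p depends on the representation and can be too large: C_0((0,1]) is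
  hereditary in C([0,1]), but acts nondegenerately on L^2, so p = 1 and the corner meets C([0,1]) in
  everything. What rescues the corona is a double-annihilator property. Failure of approximation by
  H is witnessed by an element of B that kills H, and annihilation, unlike approximation, can be
  read off in any faithful representation. Approximate units here need neither increase nor commute,
  so the terms of the annihilating sum cannot be expected to be exactly orthogonal. Quantitative
  near-orthogonality with geometrically decreasing errors takes its place: it bounds the partial
  sums, gives strict convergence, and allows a single term to be recovered from the sum. The corona
  carries only the structure of a normed *-algebra here, so every estimate that uses the C*-identity
  or completeness is made in D or in M(D) and then passed to the quotient.\<close>

lemma bounded_linear_scaleC_right: "bounded_linear ((*\<^sub>C) c :: 'a::complex_normed_vector \<Rightarrow> 'a)"
  by (rule bounded_linear_intro[where K = "cmod c"])
    (simp_all add: scaleC_add_right scaleC_scaleR norm_scaleC)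

lemma bounded_linear_star: "bounded_linear (star :: 'a::normed_star_algebra \<Rightarrow> 'a)"
  by (rule bounded_linear_intro[where K = 1]) (simp_all add: star_add star_scaleR norm_star)

section \<open>Elementary identities for the complex inner product\<close>

lemma cinner_add_right: "cinner x (y + z) = cinner x y + cinner x (z::'a::complex_inner)"
  by (metis cinner_add_left cinner_commute complex_cnj_add)

lemma cinner_scaleC_right: "cinner x (c *\<^sub>C y) = cnj c * cinner x (y::'a::complex_inner)"
  by (metis cinner_scaleC_left cinner_commute complex_cnj_mult)

lemma cinner_zero_left: "cinner 0 (y::'a::complex_inner) = 0"
  using cinner_add_left[of 0 0 y] by simp

lemma cinner_zero_right: "cinner (x::'a::complex_inner) 0 = 0"
  using cinner_add_right[of x 0 0] by simp

lemma cinner_minus_left: "cinner (- x) y = - cinner x (y::'a::complex_inner)"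
  using cinner_add_left[of x "- x" y] by (simp add: cinner_zero_left minus_unique)

lemma cinner_minus_right: "cinner x (- y) = - cinner x (y::'a::complex_inner)"
  using cinner_add_right[of x y "- y"] by (simp add: cinner_zero_right minus_unique)

lemma cinner_diff_left: "cinner (x - y) z = cinner x z - cinner y (z::'a::complex_inner)"
  using cinner_add_left[of x "- y" z] by (simp add: cinner_minus_left)

lemma cinner_diff_right: "cinner x (y - z) = cinner x y - cinner x (z::'a::complex_inner)"
  using cinner_add_right[of x y "- z"] by (simp add: cinner_minus_right)

lemma norm_power2_cinner: "(norm x)\<^sup>2 = Re (cinner x (x::'a::complex_inner))"
  by (simp add: cinner_norm)

lemma cinner_ext:
  fixes x y :: "'a::complex_inner"
  assumes "\<And>z. cinner x z = cinner y z"
  shows "x = y"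
proof -
  have "cinner (x - y) (x - y) = 0"
    using assms[of "x - y"] by (simp add: cinner_diff_left)
  then show ?thesis by (simp add: cinner_norm)
qed

lemma norm_diff_power2:
  fixes x y :: "'a::complex_inner"
  shows "(norm (x - y))\<^sup>2 = (norm x)\<^sup>2 + (norm y)\<^sup>2 - 2 * Re (cinner x y)"
proof -
  have "Re (cinner y x) = Re (cinner x y)"
    by (metis cinner_commute complex_cnj(1) complex_cnj_cnj cnj.sel(1))
  then show ?thesis
    unfolding norm_power2_cinner by (simp add: cinner_diff_left cinner_diff_right)
qed

lemma parallelogram_law:
  fixes x y :: "'a::complex_inner"
  shows "(norm (x + y))\<^sup>2 + (norm (x - y))\<^sup>2 = 2 * (norm x)\<^sup>2 + 2 * (norm y)\<^sup>2"
  using norm_diff_power2[of x y] norm_diff_power2[of x "- y"] by (simp add: cinner_minus_right)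

lemma closest_point_in_convex:
  fixes K :: "'h::chilbert_space set"
  assumes "closed K" "convex K" "K \<noteq> {}"
  obtains k where "k \<in> K" "\<And>y. y \<in> K \<Longrightarrow> norm (x - k) \<le> norm (x - y)"
proof -
  define d where "d = infdist x K"
  have dle: "d \<le> norm (x - y)" if "y \<in> K" for y
    using infdist_le[OF that, of x] by (simp add: d_def dist_norm)
  have d0: "0 \<le> d" by (simp add: d_def infdist_nonneg)
  have "\<exists>y\<in>K. (norm (x - y))\<^sup>2 < d\<^sup>2 + inverse (real (Suc n))" for n
  proof -
    have "d < sqrt (d\<^sup>2 + inverse (real (Suc n)))"
      by (rule real_less_rsqrt) simp
    then obtain y where y: "y \<in> K" "dist x y < sqrt (d\<^sup>2 + inverse (real (Suc n)))"
      using cInf_lessD[of "dist x ` K" "sqrt (d\<^sup>2 + inverse (real (Suc n)))"] assms(3)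
      by (auto simp: d_def infdist_def)
    then have "(dist x y)\<^sup>2 < (sqrt (d\<^sup>2 + inverse (real (Suc n))))\<^sup>2"
      by (intro power_strict_mono) auto
    then show ?thesis using y(1) by (auto simp: dist_norm)
  qed
  then obtain y where yK: "\<And>n. y n \<in> K"
    and yd: "\<And>n. (norm (x - y n))\<^sup>2 < d\<^sup>2 + inverse (real (Suc n))"
    by metis
  \<comment> \<open>The midpoint of \<open>y m\<close> and \<open>y n\<close> lies in
    \<open>K\<close>, hence at distance at least \<open>d\<close> from \<open>x\<close>; the
    parallelogram law turns this into a bound on their difference.\<close>
  have close: "(norm (y m - y n))\<^sup>2 \<le> 2 * inverse (real (Suc m)) + 2 * inverse (real (Suc n))" for m n
  proof -
    have mid: "(1/2) *\<^sub>R y m + (1/2) *\<^sub>R y n \<in> K"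
      using assms(2) yK[of m] yK[of n] by (intro convexD) auto
    have "(x - y m) + (x - y n) = 2 *\<^sub>R (x - ((1/2) *\<^sub>R y m + (1/2) *\<^sub>R y n))"
      by (simp add: scaleR_right_diff_distrib scaleR_add_right scaleR_2)
    then have "2 * d \<le> norm ((x - y m) + (x - y n))"
      using dle[OF mid] by simp
    then have "(2 * d)\<^sup>2 \<le> (norm ((x - y m) + (x - y n)))\<^sup>2"
      using d0 by (intro power_mono) auto
    moreover have "norm ((x - y m) - (x - y n)) = norm (y m - y n)"
      by (metis add_diff_cancel_left' diff_diff_eq2 diff_add_cancel norm_minus_commute)
    ultimately show ?thesis
      using parallelogram_law[of "x - y m" "x - y n"] yd[of m] yd[of n]
      by (simp add: power_mult_distrib)
  qed
  have "Cauchy y"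
  proof (rule CauchyI)
    fix e :: real
    assume "0 < e"
    then have "0 < e\<^sup>2 / 4" by simp
    then obtain N where N: "inverse (real (Suc N)) < e\<^sup>2 / 4"
      using reals_Archimedean by blast
    have "norm (y m - y n) < e" if "m \<ge> N" "n \<ge> N" for m n
    proof (rule power2_less_imp_less)
      have "inverse (real (Suc m)) \<le> inverse (real (Suc N))"
           "inverse (real (Suc n)) \<le> inverse (real (Suc N))"
        using that by (auto intro!: le_imp_inverse_le)
      then show "(norm (y m - y n))\<^sup>2 < e\<^sup>2" using close[of m n] N by linarith
    qed (use \<open>0 < e\<close> in simp)
    then show "\<exists>M. \<forall>m\<ge>M. \<forall>n\<ge>M. norm (y m - y n) < e" by blast
  qed
  then obtain k where k: "y \<longlonglongrightarrow> k" using Cauchy_convergent_iff convergent_def by blast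
  show thesis
  proof
    show "k \<in> K" using assms(1) k yK closed_sequentially by blast
    have "(\<lambda>n. (norm (x - y n))\<^sup>2) \<longlonglongrightarrow> (norm (x - k))\<^sup>2"
      by (intro tendsto_intros k)
    moreover have "(\<lambda>n. d\<^sup>2 + inverse (real (Suc n))) \<longlonglongrightarrow> d\<^sup>2 + 0"
      by (intro tendsto_intros LIMSEQ_inverse_real_of_nat)
    ultimately have "(norm (x - k))\<^sup>2 \<le> d\<^sup>2 + 0"
      by (rule LIMSEQ_le) (use yd in \<open>auto intro: less_imp_le\<close>)
    then have "norm (x - k) \<le> d" using d0 by (auto intro: power2_le_imp_le)
    then show "norm (x - k) \<le> norm (x - z)" if "z \<in> K" for z using dle[OF that] by simp
  qed
qed

lemma subspace_closure:
  fixes S :: "'a::real_normed_vector set"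
  assumes "subspace S"
  shows "subspace (closure S)"
proof (rule subspaceI)
  show "0 \<in> closure S" using subspace_0[OF assms] closure_subset by blast
  show "x + y \<in> closure S" if "x \<in> closure S" "y \<in> closure S" for x y
  proof -
    obtain u v where "\<And>n. u n \<in> S" "u \<longlonglongrightarrow> x" "\<And>n. v n \<in> S" "v \<longlonglongrightarrow> y"
      using \<open>x \<in> closure S\<close> \<open>y \<in> closure S\<close> unfolding closure_sequential by blast
    then show ?thesis
      unfolding closure_sequential
      by (intro exI[of _ "\<lambda>n. u n + v n"]) (simp add: tendsto_add subspace_add[OF assms])
  qed
  show "c *\<^sub>R x \<in> closure S" if "x \<in> closure S" for c x
  proof -
    obtain u where "\<And>n. u n \<in> S" "u \<longlonglongrightarrow> x"
      using \<open>x \<in> closure S\<close> unfolding closure_sequential by blast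
    then show ?thesis
      unfolding closure_sequential
      by (intro exI[of _ "\<lambda>n. c *\<^sub>R u n"]) (simp add: tendsto_scaleR subspace_scale[OF assms])
  qed
qed

text \<open>A closest point works: if \<open>x - k\<close> had a nonzero inner product c with some y
  in \<open>K\<close>, moving \<open>k\<close> by a small multiple of c y would bring it nearer to
  \<open>x\<close>.\<close>

lemma orthogonal_decomposition:
  fixes K :: "'h::chilbert_space set"
  assumes "closed K" "subspace K" and scaleC: "\<And>c y. y \<in> K \<Longrightarrow> c *\<^sub>C y \<in> K"
  obtains k where "k \<in> K" "\<And>y. y \<in> K \<Longrightarrow> cinner (x - k) y = 0"
proof -
  obtain k where k: "k \<in> K" and min: "\<And>y. y \<in> K \<Longrightarrow> norm (x - k) \<le> norm (x - y)"
    using closest_point_in_convex[of K x] assms subspace_imp_convex[of K] subspace_0[of K] by blast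
  have "cinner (x - k) y = 0" if y: "y \<in> K" for y
  proof (rule ccontr)
    define c where "c = cinner (x - k) y"
    assume "cinner (x - k) y \<noteq> 0"
    then have c: "(cmod c)\<^sup>2 > 0" by (simp add: c_def)
    \<comment> \<open>Any positive \<open>t\<close> with \<open>t * (norm y)\<^sup>2 < 2\<close>
      contradicts minimality; the added 1 keeps the denominator positive.\<close>
    define t where "t = inverse ((norm y)\<^sup>2 + 1)"
    have n1: "0 < (norm y)\<^sup>2 + 1" by (rule add_nonneg_pos) auto
    then have t: "t > 0" by (simp add: t_def)
    have t2: "t * (norm y)\<^sup>2 < 1"
      using n1 by (simp add: t_def field_simps)
    let ?l = "of_real t * c"
    have "norm (x - k) \<le> norm (x - k - ?l *\<^sub>C y)"
      using min[of "k + ?l *\<^sub>C y"] subspace_add[OF assms(2) k scaleC[OF y]]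
      by (simp add: diff_diff_eq)
    then have "(norm (x - k))\<^sup>2 \<le> (norm (x - k - ?l *\<^sub>C y))\<^sup>2"
      by (intro power_mono) auto
    also have "\<dots> = (norm (x - k))\<^sup>2 + (norm (?l *\<^sub>C y))\<^sup>2 - 2 * Re (cnj ?l * c)"
      by (simp add: norm_diff_power2[of "x - k"] cinner_scaleC_right c_def)
    also have "Re (cnj ?l * c) = t * (cmod c)\<^sup>2"
      unfolding cmod_power2 by (simp add: power2_eq_square algebra_simps)
    also have "(norm (?l *\<^sub>C y))\<^sup>2 = t * (cmod c)\<^sup>2 * (t * (norm y)\<^sup>2)"
      by (simp add: norm_scaleC norm_mult power_mult_distrib power2_eq_square)
    finally have "t * (cmod c)\<^sup>2 * 2 \<le> t * (cmod c)\<^sup>2 * (t * (norm y)\<^sup>2)" by simp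
    then have "2 \<le> t * (norm y)\<^sup>2" using t c by (simp add: mult_le_cancel_left)
    then show False using t2 by simp
  qed
  with k that show thesis by blast
qed

lemma projection_onto_closed_subspace:
  fixes K :: "'h::chilbert_space set"
  assumes "closed K" "subspace K" and scaleC: "\<And>c y. y \<in> K \<Longrightarrow> c *\<^sub>C y \<in> K"
  obtains p :: "'h \<Rightarrow>\<^sub>L 'h" where "projection p" "\<And>x. p x \<in> K" "\<And>x. x \<in> K \<Longrightarrow> p x = x"
proof -
  obtain P where PK: "\<And>x. P x \<in> K" and orth: "\<And>x y. y \<in> K \<Longrightarrow> cinner (x - P x) y = 0"
  proof -
    have "\<exists>k. k \<in> K \<and> (\<forall>y\<in>K. cinner (x - k) y = 0)" for x
      by (rule orthogonal_decomposition[of K x]) (use assms in auto)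
    then show thesis using that by metis
  qed
  \<comment> \<open>Linearity of \<open>P\<close> and \<open>P x = x\<close> on \<open>K\<close>
    follow by checking that the expected value has the defining orthogonality.\<close>
  have unique: "P x = k" if "k \<in> K" "\<And>y. y \<in> K \<Longrightarrow> cinner (x - k) y = 0" for x k
  proof -
    have "P x - k \<in> K" using that(1) PK subspace_diff[OF assms(2)] by blast
    from that(2)[OF this] orth[OF this, of x] have "cinner (P x - k) (P x - k) = 0"
      by (simp add: cinner_diff_left)
    then show ?thesis by (simp add: cinner_norm)
  qed
  have add: "P (x + y) = P x + P y" for x y
    by (rule unique)
      (use PK subspace_add[OF assms(2)] orth in \<open>auto simp: add_diff_add cinner_add_left\<close>)
  have scale: "P (c *\<^sub>C x) = c *\<^sub>C P x" for c x
    by (rule unique)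
      (use PK scaleC orth in \<open>auto simp: cinner_scaleC_left simp flip: scaleC_diff_right\<close>)
  have bound: "norm (P x) \<le> norm x" for x
  proof (rule power2_le_imp_le)
    have "(norm x)\<^sup>2 = (norm (P x))\<^sup>2 + (norm (x - P x))\<^sup>2"
      using norm_diff_power2[of "x - P x" "- P x"] orth[OF PK, of x x] by (simp add: cinner_minus_right)
    then show "(norm (P x))\<^sup>2 \<le> (norm x)\<^sup>2" by simp
  qed simp
  have "bounded_linear P"
    by (rule bounded_linear_intro[where K = 1])
      (use scale[of "of_real _"] in \<open>simp_all add: add bound scaleC_of_real\<close>)
  then have p: "blinfun_apply (Blinfun P) = P" by (rule bounded_linear_Blinfun_apply)
  have id: "P x = x" if "x \<in> K" for x
    using that by (intro unique) (auto simp: cinner_zero_left)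
  show thesis
  proof
    have "cinner (P x) y = cinner x (P y)" for x y
    proof -
      have "cinner (P x) (y - P y) = 0" using orth[OF PK, of y x] by (metis cinner_commute complex_cnj_zero)
      moreover have "cinner (x - P x) (P y) = 0" using orth[OF PK] .
      ultimately show ?thesis by (simp add: cinner_diff_left cinner_diff_right)
    qed
    then show "projection (Blinfun P)"
      unfolding projection_def is_adjoint_def bounded_ops_def
      by (auto intro!: blinfun_eqI simp: p scale id PK)
  qed (simp_all add: p PK id)
qed

section \<open>Hereditary subalgebras of the corona\<close>

text \<open>Unit-free form of \<open>y = 1 - sqrt (1 - z)\<close>, obtained as a fixed point of
  \<open>y \<mapsto> (z + y\<^sup>2) / 2\<close>. It makes \<open>star a * (1 - z) * a\<close> a positive element.\<close>

lemma ex_self_adjoint_quadratic_root: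
  fixes z :: "'a::cstar_algebra"
  assumes z: "star z = z" "norm z \<le> 1/4"
  obtains y where "star y = y" "z = 2 *\<^sub>R y - y * y"
proof -
  let ?f = "\<lambda>y. (1/2) *\<^sub>R (z + y * y)"
  have "\<exists>!y. y \<in> cball 0 (1/2) \<and> ?f y = y"
  proof (rule Banach_fix[where c = "1/2"])
    show "complete (cball (0::'a) (1/2))" by (simp add: complete_eq_closed)
    show "?f ` cball 0 (1/2) \<subseteq> cball 0 (1/2)"
    proof clarify
      fix y :: 'a assume "y \<in> cball 0 (1/2)"
      then have "norm (y * y) \<le> (1/2) * (1/2)"
        by (intro order_trans[OF norm_mult_ineq] mult_mono) auto
      then show "?f y \<in> cball 0 (1/2)" using z(2) norm_triangle_ineq[of z "y * y"] by simp
    qed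
    show "dist (?f x) (?f y) \<le> (1/2) * dist x y" if "x \<in> cball 0 (1/2)" "y \<in> cball 0 (1/2)" for x y
    proof -
      have "?f x - ?f y = (1/2) *\<^sub>R (x * (x - y) + (x - y) * y)"
        by (simp add: algebra_simps flip: scaleR_diff_right)
      then have "2 * norm (?f x - ?f y) = norm (x * (x - y) + (x - y) * y)" by simp
      also have "\<dots> \<le> norm (x * (x - y)) + norm ((x - y) * y)" by (rule norm_triangle_ineq)
      also have "\<dots> \<le> norm x * norm (x - y) + norm (x - y) * norm y"
        by (intro add_mono norm_mult_ineq)
      also have "\<dots> \<le> (1/2) * norm (x - y) + norm (x - y) * (1/2)"
        using that by (intro add_mono mult_mono) auto
      finally show ?thesis by (simp add: dist_norm)
    qed
  qed simp_all
  then obtain y where y: "y \<in> cball 0 (1/2)" "?f y = y"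
    and uniq: "\<And>y'. y' \<in> cball 0 (1/2) \<Longrightarrow> ?f y' = y' \<Longrightarrow> y' = y" by metis
  have "?f (star y) = star (?f y)" by (simp only: star_scaleR star_add star_mult z(1))
  then have "star y = y" using y by (intro uniq) (simp_all add: norm_star)
  moreover have "2 *\<^sub>R y = 2 *\<^sub>R ?f y" by (simp only: y(2))
  then have "z = 2 *\<^sub>R y - y * y" by simp
  ultimately show thesis by (rule that)
qed

section \<open>Units of the multiplier algebra and of the corona\<close>

lift_definition multiplier_one :: "'a::cstar_algebra multiplier" is "(id_blinfun, id_blinfun)"
  by (simp add: bounded_ops_def)

lemma
  shows left_mult_one: "left_mult multiplier_one = id_blinfun"
    and right_mult_one: "right_mult multiplier_one = id_blinfun"
  by (simp_all add: left_mult_def right_mult_def multiplier_one.rep_eq)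

lemma multiplier_one_mult: "multiplier_one * m = m"
  and multiplier_mult_one: "m * multiplier_one = m"
  by (rule multiplier_eqI; rule blinfun_eqI;
      simp add: multiplier_simps left_mult_one right_mult_one)+

lemma norm_multiplier_one_le: "norm (multiplier_one :: 'a::cstar_algebra multiplier) \<le> 1"
  unfolding norm_multiplier_def left_mult_one by (rule norm_blinfun_bound) auto

text \<open>A bare constant, because unital ring classes demand \<open>0 \<noteq> 1\<close>, which
  fails in the corona of a unital algebra. For the same reason its norm is only bounded by
  1.\<close>

lift_definition corona_one :: "'a::cstar_algebra corona" is multiplier_one .

lemma corona_one_mult: "corona_one * x = x"
  by transfer (simp add: multiplier_one_mult ideal_zero)

lemma corona_mult_one: "x * corona_one = x"
  by transfer (simp add: multiplier_mult_one ideal_zero)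

lemma star_corona_one: "star corona_one = corona_one"
  by (metis corona_one_mult corona_mult_one star_mult star_star)

lemma norm_corona_one_le: "norm (corona_one :: 'a::cstar_algebra corona) \<le> 1"
  using norm_abs_corona_le[of multiplier_one] norm_multiplier_one_le
  by (metis corona_one.abs_eq order_trans)

lemma abs_corona_surj: obtains m where "x = abs_corona m"
  using Quotient3_abs_rep[OF Quotient3_corona, of x, symmetric] by (rule that)

lemma abs_corona_eq_0_iff: "abs_corona m = 0 \<longleftrightarrow> m \<in> ideal_of_algebra"
  by (simp add: zero_corona_def corona.abs_eq_iff)

text \<open>The right-hand side is 1 - (1 - s)^2, so a multiple of \<open>star y * y\<close> lies
  below the unit and the difference is a square. The root is found in M(D) and projected to the
  corona.\<close>

lemma corona_quadratic_root:
  fixes y :: "'a::cstar_algebra corona"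
  obtains k :: real and s where "k > 0" "star s = s" "k *\<^sub>R (star y * y) = 2 *\<^sub>R s - s * s"
proof -
  obtain m where m: "y = abs_corona m" by (rule abs_corona_surj)
  \<comment> \<open>Brings \<open>k *\<^sub>R (star m * m)\<close> to norm at most 1/4, where the
    fixed-point root exists; the added 1 covers \<open>m = 0\<close>.\<close>
  define k where "k = inverse (4 * ((norm m)\<^sup>2 + 1))"
  have pos: "0 < (norm m)\<^sup>2 + 1" by (rule add_nonneg_pos) auto
  then have k: "k > 0" by (simp add: k_def)
  have "norm (k *\<^sub>R (star m * m)) = k * (norm m)\<^sup>2"
    using k by (simp add: cstar_identity)
  also have "\<dots> \<le> 1/4" using pos by (simp add: k_def field_simps)
  finally obtain s where s: "star s = s" "k *\<^sub>R (star m * m) = 2 *\<^sub>R s - s * s"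
    by (rule ex_self_adjoint_quadratic_root[rotated])
      (simp add: star_scaleR star_mult star_star)+
  show thesis
  proof
    show "star (abs_corona s) = abs_corona s" by (simp add: star_corona.abs_eq s(1))
    show "k *\<^sub>R (star y * y) = 2 *\<^sub>R abs_corona s - abs_corona s * abs_corona s"
      using arg_cong[OF s(2), of abs_corona]
      by (simp add: m star_corona.abs_eq times_corona.abs_eq scaleR_corona.abs_eq minus_corona.abs_eq)
  qed (rule k)
qed

lemma star_sandwich_polarization:
  fixes u v y :: "'a::normed_star_algebra"
  shows "4 *\<^sub>R (star u * y * v) =
    (star (v + u) * y * (v + u) - star (v - u) * y * (v - u)) +
    \<i> *\<^sub>C (star (v + \<i> *\<^sub>C u) * y * (v + \<i> *\<^sub>C u) - star (v - \<i> *\<^sub>C u) * y * (v - \<i> *\<^sub>C u))"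
proof -
  let ?A = "star u * y * v" and ?B = "star v * y * u"
  \<comment> \<open>The real pair contributes 2A + 2B. Replacing \<open>u\<close> by
    \<open>\<i> *\<^sub>C u\<close> and multiplying by \<i> gives 2A - 2B, so B cancels.\<close>
  have 1: "star (v + u) * y * (v + u) - star (v - u) * y * (v - u) =
      2 *\<^sub>R (star u * y * v) + 2 *\<^sub>R (star v * y * u)" for u
    by (simp add: star_add star_diff algebra_simps scaleR_2)
  have m: "(-1) *\<^sub>C x = - (x::'a)" for x
    using scaleC_of_real[of "-1" x] by simp
  have "\<i> *\<^sub>C (2 *\<^sub>R (star (\<i> *\<^sub>C u) * y * v) + 2 *\<^sub>R (star v * y * (\<i> *\<^sub>C u))) = 2 *\<^sub>R ?A - 2 *\<^sub>R ?B"
    by (simp add: star_scaleC mult_scaleC_left mult_scaleC_right scaleC_add_right scaleC_scaleR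
        scaleC_scaleC scaleC_one m)
  then show ?thesis
    unfolding 1 by (simp flip: scaleR_add_left)
qed

lemma
  assumes "cstar_subalgebra A"
  shows cstar_subalgebra_add: "x \<in> A \<Longrightarrow> y \<in> A \<Longrightarrow> x + y \<in> A"
    and cstar_subalgebra_mult: "x \<in> A \<Longrightarrow> y \<in> A \<Longrightarrow> x * y \<in> A"
    and cstar_subalgebra_scaleC: "x \<in> A \<Longrightarrow> c *\<^sub>C x \<in> A"
    and cstar_subalgebra_star: "x \<in> A \<Longrightarrow> star x \<in> A"
    and cstar_subalgebra_closed: "closed A"
  using assms by (auto simp: cstar_subalgebra_def)

lemma cstar_subalgebra_scaleR: "cstar_subalgebra A \<Longrightarrow> x \<in> A \<Longrightarrow> r *\<^sub>R x \<in> A"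
  by (metis cstar_subalgebra_scaleC scaleC_of_real)

lemma cstar_subalgebra_diff: "cstar_subalgebra A \<Longrightarrow> x \<in> A \<Longrightarrow> y \<in> A \<Longrightarrow> x - y \<in> A"
  using cstar_subalgebra_add[of A x "(-1) *\<^sub>R y"] cstar_subalgebra_scaleR[of A y "-1"] by simp

lemma polarization_mem:
  assumes A: "cstar_subalgebra A"
    and "\<And>w. w \<in> {v + u, v - u, v + \<i> *\<^sub>C u, v - \<i> *\<^sub>C u} \<Longrightarrow> star w * y * w \<in> A"
  shows "star u * y * v \<in> A"
proof -
  have "4 *\<^sub>R (star u * y * v) \<in> A"
    unfolding star_sandwich_polarization
    by (intro cstar_subalgebra_add[OF A] cstar_subalgebra_diff[OF A] cstar_subalgebra_scaleC[OF A]
        assms(2)) simp_all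
  from cstar_subalgebra_scaleR[OF A this, of "1/4"] show ?thesis by simp
qed

text \<open>Heredity speaks only of positive elements: a multiple of
  \<open>star a * (star y * y) * a\<close> is dominated by \<open>star a * a\<close>. One
  polarization then frees the middle factor, a second one the outer factors.\<close>

lemma hereditary_sandwich:
  fixes H :: "'a::cstar_algebra corona set"
  assumes her: "hereditary_cstar_subalgebra H" and "a \<in> H" "c \<in> H"
  shows "a * y * c \<in> H"
proof -
  have H: "cstar_subalgebra H" using her by (simp add: hereditary_cstar_subalgebra_def)
  have sq: "star a * (star y * corona_one * y) * a \<in> H" if a: "a \<in> H" for a y
  proof -
    obtain k s where k: "k > 0" and s: "star s = s" "k *\<^sub>R (star y * y) = 2 *\<^sub>R s - s * s"
      by (rule corona_quadratic_root)
    let ?x = "k *\<^sub>R (star a * (star y * y) * a)"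
    have "?x = star (sqrt k *\<^sub>R (y * a)) * (sqrt k *\<^sub>R (y * a))"
      using k by (simp add: star_scaleR star_mult mult.assoc)
    then have "?x \<in> positive_elements UNIV" unfolding positive_elements_def by blast
    moreover have "star a * a - ?x = star (a - s * a) * (a - s * a)"
    proof -
      have "?x = star a * (2 *\<^sub>R s - s * s) * a" by (simp flip: s(2))
      then show ?thesis by (simp add: star_diff star_mult s(1) algebra_simps scaleR_2)
    qed
    then have "star a * a - ?x \<in> positive_elements UNIV" unfolding positive_elements_def by blast
    moreover have "star a * a \<in> H" by (intro cstar_subalgebra_mult[OF H] cstar_subalgebra_star[OF H] a)
    ultimately have "?x \<in> H" using her by (auto simp: hereditary_cstar_subalgebra_def)
    from cstar_subalgebra_scaleR[OF H this, of "1/k"] show ?thesis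
      using k by (simp add: corona_mult_one)
  qed
  have diag: "star a * y * a \<in> H" if a: "a \<in> H" for a y
  proof -
    let ?q = "\<lambda>z. star a * (star z * corona_one * z) * a"
    \<comment> \<open>Polarizing with \<open>u\<close> and the middle factor both
      \<open>corona_one\<close> writes \<open>y\<close> through elements
      \<open>star z * corona_one * z\<close>, the shape in which \<open>sq\<close> is
      stated.\<close>
    have "4 *\<^sub>R (star a * y * a) = star a * (4 *\<^sub>R (star corona_one * corona_one * y)) * a"
      by (simp add: star_corona_one corona_one_mult)
    also have "\<dots> = (?q (y + corona_one) - ?q (y - corona_one)) +
        \<i> *\<^sub>C (?q (y + \<i> *\<^sub>C corona_one) - ?q (y - \<i> *\<^sub>C corona_one))"
      unfolding star_sandwich_polarization
      by (simp only: distrib_left distrib_right left_diff_distrib right_diff_distrib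
          mult_scaleC_left mult_scaleC_right)
    also have "\<dots> \<in> H"
      by (intro cstar_subalgebra_add[OF H] cstar_subalgebra_diff[OF H] cstar_subalgebra_scaleC[OF H] sq a)
    finally have "4 *\<^sub>R (star a * y * a) \<in> H" .
    from cstar_subalgebra_scaleR[OF H this, of "1/4"] show ?thesis by simp
  qed
  have "star (star a) * y * c \<in> H"
    by (rule polarization_mem[OF H], rule diag)
      (use assms in \<open>auto intro!: cstar_subalgebra_add[OF H] cstar_subalgebra_diff[OF H]
          cstar_subalgebra_scaleC[OF H] cstar_subalgebra_star[OF H]\<close>)
  then show ?thesis by (simp add: star_star)
qed

lemma positive_elements_self_adjoint: "e \<in> positive_elements A \<Longrightarrow> star e = e"
  by (auto simp: positive_elements_def star_mult star_star)

lemma positive_elements_subset: "cstar_subalgebra A \<Longrightarrow> positive_elements A \<subseteq> A"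
  by (auto simp: positive_elements_def intro: cstar_subalgebra_mult cstar_subalgebra_star)

section \<open>Near-orthogonal sums\<close>

lemma norm_self_adjoint_square: "star x = x \<Longrightarrow> norm (x * x) = (norm (x::'a::cstar_algebra))\<^sup>2"
  using cstar_identity[of x] by simp

text \<open>If \<open>A\<close> and \<open>B\<close> were orthogonal, then \<open>(A + B)\<^sup>2 = A\<^sup>2 + B\<^sup>2\<close>. So an excess of
  \<open>norm (A + B)\<close> over 1 at least doubles under squaring both, while \<open>norm (A + B)\<close> never exceeds 2.\<close>

lemma norm_add_self_adjoint_le:
  fixes A B :: "'a::cstar_algebra"
  assumes "star A = A" "star B = B" "norm A \<le> 1" "norm B \<le> 1"
    and "0 < \<eta>" "norm (A * B) \<le> \<eta>\<^sup>2 / 2"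
  shows "norm (A + B) \<le> 1 + \<eta>"
proof (rule ccontr)
  assume "\<not> norm (A + B) \<le> 1 + \<eta>"
  then have gt: "norm (A + B) > 1 + \<eta>" by simp
  have "\<exists>A B :: 'a. star A = A \<and> star B = B \<and> norm A \<le> 1 \<and> norm B \<le> 1 \<and>
      norm (A * B) \<le> \<eta>\<^sup>2 / 2 \<and> norm (A + B) > 1 + 2 ^ n * \<eta>" for n
  proof (induction n)
    case 0
    then show ?case using assms gt by auto
  next
    case (Suc n)
    then obtain A B :: 'a where sa: "star A = A" "star B = B" and le: "norm A \<le> 1" "norm B \<le> 1"
      and AB: "norm (A * B) \<le> \<eta>\<^sup>2 / 2" and large: "norm (A + B) > 1 + 2 ^ n * \<eta>" by blast
    have BA: "norm (B * A) \<le> \<eta>\<^sup>2 / 2"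
      using AB norm_star[of "A * B"] by (simp add: star_mult sa)
    have \<eta>n: "\<eta> \<le> 2 ^ n * \<eta>" using \<open>0 < \<eta>\<close> by simp
    have "(1 + 2 ^ n * \<eta>)\<^sup>2 < (norm (A + B))\<^sup>2"
      using large \<open>0 < \<eta>\<close> by (intro power_strict_mono) (auto intro: add_nonneg_nonneg)
    also have "\<dots> = norm ((A * A + B * B) + (A * B + B * A))"
      by (subst norm_self_adjoint_square[symmetric]) (simp_all add: star_add sa algebra_simps)
    also have "\<dots> \<le> norm (A * A + B * B) + (norm (A * B) + norm (B * A))"
      by (intro order_trans[OF norm_triangle_ineq] add_left_mono norm_triangle_ineq)
    also have "\<dots> \<le> norm (A * A + B * B) + \<eta>\<^sup>2" using AB BA by simp
    \<comment> \<open>The cross-term error is absorbed by the quadratic term of (1 + t)^2 with t =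
      \<open>2 ^ n * \<eta>\<close>, which leaves 1 + 2t.\<close>
    also have "\<eta>\<^sup>2 \<le> (2 ^ n * \<eta>)\<^sup>2" using \<eta>n \<open>0 < \<eta>\<close> by (intro power_mono) auto
    finally have "1 + 2 ^ Suc n * \<eta> < norm (A * A + B * B)"
      by (simp add: power2_eq_square algebra_simps)
    moreover have "norm (A * A * (B * B)) \<le> \<eta>\<^sup>2 / 2"
    proof -
      have "norm (A * (A * B) * B) \<le> norm A * norm (A * B) * norm B"
        by (intro order_trans[OF norm_mult_ineq] mult_right_mono norm_mult_ineq) simp
      also have "\<dots> \<le> 1 * (\<eta>\<^sup>2 / 2) * 1"
        using le AB by (intro mult_mono) auto
      finally show ?thesis by (simp add: mult.assoc)
    qed
    ultimately show ?case
      by (intro exI[of _ "A * A"] exI[of _ "B * B"])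
        (use sa le in \<open>simp add: star_mult norm_self_adjoint_square power_le_one\<close>)
  qed
  moreover obtain n where "1 < 2 ^ n * \<eta>"
    using reals_power_lt_ex[OF \<open>0 < \<eta>\<close>, of 2] by (auto simp: field_simps)
  ultimately obtain A B :: 'a where "norm A \<le> 1" "norm B \<le> 1" "norm (A + B) > 1 + 2 ^ n * \<eta>" by blast
  with norm_triangle_ineq[of A B] \<open>1 < 2 ^ n * \<eta>\<close> show False by simp
qed

text \<open>After the C*-identity, \<open>star x * y\<close> controls the cross terms, while
  \<open>x * star y\<close> sits inside the product of the self-adjoint contractions
  \<open>star x * x\<close> and \<open>star y * y\<close>. So both products must be small.\<close>

lemma norm_add_near_orthogonal_unit:
  fixes x y :: "'a::cstar_algebra"
  assumes "norm x \<le> 1" "norm y \<le> 1" "0 < \<eta>" "\<eta> \<le> 1"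
    and "norm (star x * y) \<le> \<eta>\<^sup>2 / 2" "norm (x * star y) \<le> \<eta>\<^sup>2 / 2"
  shows "norm (x + y) \<le> 1 + \<eta>"
proof (rule power2_le_imp_le)
  have "norm (star x * (x * star y) * y) \<le> norm (star x) * norm (x * star y) * norm y"
    by (intro order_trans[OF norm_mult_ineq] mult_right_mono norm_mult_ineq) simp
  also have "\<dots> \<le> 1 * (\<eta>\<^sup>2 / 2) * 1"
    using assms by (intro mult_mono) (auto simp: norm_star)
  finally have "norm ((star x * x) * (star y * y)) \<le> \<eta>\<^sup>2 / 2" by (simp add: mult.assoc)
  then have sum: "norm (star x * x + star y * y) \<le> 1 + \<eta>"
    using assms by (intro norm_add_self_adjoint_le)
      (simp_all add: star_mult star_star cstar_identity power_le_one)
  have "norm (star y * x) = norm (star x * y)"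
    using norm_star[of "star x * y"] by (simp add: star_mult star_star)
  then have cross: "norm (star x * y + star y * x) \<le> \<eta>\<^sup>2"
    using norm_triangle_ineq[of "star x * y" "star y * x"] assms by simp
  have "(norm (x + y))\<^sup>2 = norm ((star x * x + star y * y) + (star x * y + star y * x))"
    by (simp add: cstar_identity[symmetric] star_add algebra_simps)
  also have "\<dots> \<le> (1 + \<eta>) + \<eta>\<^sup>2"
    using norm_triangle_ineq sum cross add_mono order_trans by blast
  also have "\<dots> \<le> (1 + \<eta>)\<^sup>2" using assms by (simp add: power2_eq_square algebra_simps)
  finally show "(norm (x + y))\<^sup>2 \<le> (1 + \<eta>)\<^sup>2" .
qed (use assms in simp)

text \<open>Scaling by 1/K reduces to contractions, and \<open>1 \<le> K\<close> preserves the
  smallness of the products. The multiplicative bound can be iterated along partial sums.\<close>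

lemma norm_add_near_orthogonal:
  fixes x y :: "'a::cstar_algebra"
  assumes "1 \<le> K" "norm x \<le> K" "norm y \<le> K" "0 < \<eta>" "\<eta> \<le> 1"
    and "norm (star x * y) \<le> \<eta>\<^sup>2 / 2" "norm (x * star y) \<le> \<eta>\<^sup>2 / 2"
  shows "norm (x + y) \<le> K * (1 + \<eta>)"
proof -
  have K: "c / (K * K) \<le> \<eta>\<^sup>2 / 2" if "0 \<le> c" "c \<le> \<eta>\<^sup>2 / 2" for c
  proof -
    have "c / (K * K) \<le> c / 1"
      using that assms(1) mult_mono[of 1 K 1 K] by (intro divide_left_mono) auto
    then show ?thesis using that by linarith
  qed
  have eq: "star ((1/K) *\<^sub>R x) * (1/K) *\<^sub>R y = (1/(K * K)) *\<^sub>R (star x * y)"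
    "(1/K) *\<^sub>R x * star ((1/K) *\<^sub>R y) = (1/(K * K)) *\<^sub>R (x * star y)"
    by (simp_all add: star_scaleR)
  have "norm (star ((1/K) *\<^sub>R x) * (1/K) *\<^sub>R y) \<le> \<eta>\<^sup>2 / 2"
    "norm ((1/K) *\<^sub>R x * star ((1/K) *\<^sub>R y)) \<le> \<eta>\<^sup>2 / 2"
    unfolding eq using K[OF norm_ge_zero assms(6)] K[OF norm_ge_zero assms(7)] by simp_all
  moreover have "norm ((1/K) *\<^sub>R x) \<le> 1" "norm ((1/K) *\<^sub>R y) \<le> 1"
    using assms(1-3) by (simp_all add: field_simps)
  ultimately have "norm ((1/K) *\<^sub>R x + (1/K) *\<^sub>R y) \<le> 1 + \<eta>"
    using assms(4,5) by (intro norm_add_near_orthogonal_unit)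
  then have "norm (x + y) / K \<le> 1 + \<eta>"
    using assms(1) by (simp flip: scaleR_add_right)
  then show ?thesis using assms(1) by (simp add: field_simps)
qed

text \<open>Multiplying by 1 - d_M nearly kills \<open>F\<close> but changes \<open>y\<close> only
  by an element of the ideal, so its distance to the ideal survives; the factor d_N brings the
  multiplier back into the algebra. \<open>right_mult y z\<close> is the product z y.\<close>

lemma far_out_element:
  fixes y :: "'a::cstar_algebra multiplier" and d :: "nat \<Rightarrow> 'a"
  assumes d: "\<And>n. norm (d n) \<le> 1" "\<And>a. (\<lambda>n. d n * a) \<longlonglongrightarrow> a" "\<And>a. (\<lambda>n. a * d n) \<longlonglongrightarrow> a"
    and "finite F" "0 < \<delta>" "0 \<le> \<epsilon>" "infdist y ideal_of_algebra > \<epsilon>"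
  obtains z where "norm z \<le> 2" "\<And>a. a \<in> F \<Longrightarrow> norm (z * a) \<le> \<delta>" "\<And>a. a \<in> F \<Longrightarrow> norm (a * z) \<le> \<delta>"
    "norm (right_mult y z) > \<epsilon>"
proof -
  have "\<forall>\<^sub>F n in sequentially. \<forall>a\<in>F. dist (d n * a) a < \<delta> \<and> dist (a * d n) a < \<delta>"
    using assms d by (intro eventually_ball_finite ballI eventually_conj tendstoD) auto
  then obtain M where M: "\<And>a. a \<in> F \<Longrightarrow> dist (d M * a) a < \<delta>" "\<And>a. a \<in> F \<Longrightarrow> dist (a * d M) a < \<delta>"
    by (metis (no_types, lifting) eventually_sequentially order_refl)
  define y' where "y' = y - of_algebra (d M) * y"
  have "y - y' \<in> ideal_of_algebra" by (simp add: y'_def ideal_mult_right)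
  from infdist_ideal_le[OF this] have "norm y' > \<epsilon>" using assms by simp
  \<comment> \<open>An operator norm above \<epsilon> is witnessed at some \<open>c\<close>. Since
    z_N y tends to \<open>y'\<close> only strictly, the lower bound is transferred by testing at
    this \<open>c\<close>.\<close>
  then obtain c where c: "norm (left_mult y' c) > \<epsilon> * norm c"
    using norm_blinfun_bound[of \<epsilon> "left_mult y'"] \<open>0 \<le> \<epsilon>\<close>
    by (force simp: norm_multiplier_def not_le[symmetric])
  define z where "z N = d N - d M * d N" for N
  have norm_z: "norm (z N) \<le> 2" for N
  proof -
    have "norm (d M * d N) \<le> 1 * 1"
      using d(1) by (intro order_trans[OF norm_mult_ineq] mult_mono) auto
    then show ?thesis
      using norm_triangle_ineq4[of "d N" "d M * d N"] d(1)[of N] by (simp add: z_def)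
  qed
  have zlim: "(\<lambda>N. z N * a) \<longlonglongrightarrow> a - d M * a" for a
    unfolding z_def left_diff_distrib mult.assoc by (intro tendsto_intros d)
  have az: "norm (a * z N) \<le> \<delta>" if "a \<in> F" for a N
  proof -
    have "a * z N = (a - a * d M) * d N" by (simp add: z_def algebra_simps)
    also have "norm \<dots> \<le> norm (a - a * d M) * 1"
      using d(1) by (intro order_trans[OF norm_mult_ineq] mult_left_mono) auto
    finally show ?thesis using M(2)[OF that] by (simp add: dist_norm norm_minus_commute)
  qed
  have za: "\<forall>\<^sub>F N in sequentially. \<forall>a\<in>F. norm (z N * a) < \<delta>"
    using M(1) assms
    by (intro eventually_ball_finite ballI order_tendstoD(2)[OF tendsto_norm[OF zlim]])
      (auto simp: dist_norm norm_minus_commute)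
  have "(\<lambda>N. right_mult y (z N) * c) \<longlonglongrightarrow> left_mult y' c"
    using zlim[of "left_mult y c"]
    by (simp add: right_mult_left_mult y'_def multiplier_simps left_mult_of_algebra blinfun.diff_left)
  then have "\<forall>\<^sub>F N in sequentially. norm (right_mult y (z N) * c) > \<epsilon> * norm c"
    using c by (intro order_tendstoD(1)[OF tendsto_norm]) auto
  with za obtain N where N: "\<And>a. a \<in> F \<Longrightarrow> norm (z N * a) < \<delta>"
    "norm (right_mult y (z N) * c) > \<epsilon> * norm c"
    using eventually_happens'[OF sequentially_bot eventually_conj] by (metis (no_types, lifting))
  have "\<epsilon> * norm c < norm (right_mult y (z N)) * norm c"
    using N(2) norm_mult_ineq less_le_trans by blast
  then have "norm (right_mult y (z N)) > \<epsilon>"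
    using mult_right_less_imp_less norm_ge_zero by blast
  then show thesis
    using norm_z az N(1) by (intro that[of "z N"]) (auto intro: less_imp_le)
qed

lemma norm_right_mult_apply: "norm (right_mult m a) \<le> norm m * norm a"
  using norm_blinfun[of "right_mult m" a] by (simp add: norm_right_mult)

lemma norm_left_mult_apply: "norm (left_mult m a) \<le> norm m * norm a"
  using norm_blinfun[of "left_mult m" a] by (simp add: norm_multiplier_def)

text \<open>The element is r = z g, with z far out for \<open>g * b\<close>. Each
  \<open>g * m\<close> lies within \<delta> of some c in the algebra, so z g m = z (g m - c) + z c
  has norm at most 2\<delta> + \<delta>.\<close>

lemma far_out_multiple:
  fixes b g :: "'a::cstar_algebra multiplier" and d :: "nat \<Rightarrow> 'a"
  assumes d: "\<And>n. norm (d n) \<le> 1" "\<And>a. (\<lambda>n. d n * a) \<longlonglongrightarrow> a" "\<And>a. (\<lambda>n. a * d n) \<longlonglongrightarrow> a"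
    and "finite F" "0 < \<delta>" "0 \<le> \<epsilon>" "infdist (g * b) ideal_of_algebra > \<epsilon>"
    and g: "norm g \<le> 1/2" and "finite E"
    and E: "\<And>m. m \<in> E \<Longrightarrow> infdist (g * m) ideal_of_algebra < \<delta>"
  obtains r where "norm r \<le> 1" "\<And>a. a \<in> F \<Longrightarrow> norm (r * a) \<le> \<delta>" "\<And>a. a \<in> F \<Longrightarrow> norm (a * r) \<le> \<delta>"
    "\<And>m. m \<in> E \<Longrightarrow> norm (right_mult m r) \<le> 3 * \<delta>" "norm (right_mult b r) > \<epsilon>"
proof -
  have "\<exists>c. norm (g * m - of_algebra c) < \<delta>" if m: "m \<in> E" for m
  proof -
    obtain s where s: "g * m - s \<in> ideal_of_algebra" "norm s < infdist (g * m) ideal_of_algebra + (\<delta> - infdist (g * m) ideal_of_algebra)"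
      using infdist_ideal_approx[of "\<delta> - infdist (g * m) ideal_of_algebra" "g * m"] E[OF m] by auto
    then obtain c where "g * m - s = of_algebra c" by blast
    then have "g * m - of_algebra c = s" by (simp add: algebra_simps)
    with s(2) show ?thesis by auto
  qed
  then obtain c where c: "\<And>m. m \<in> E \<Longrightarrow> norm (g * m - of_algebra (c m)) < \<delta>" by metis
  have "finite (F \<union> left_mult g ` F \<union> c ` E)" using assms by simp
  then obtain z where z: "norm z \<le> 2" "norm (right_mult (g * b) z) > \<epsilon>"
    and zF: "\<And>a. a \<in> F \<union> left_mult g ` F \<union> c ` E \<Longrightarrow> norm (z * a) \<le> \<delta>"
      "\<And>a. a \<in> F \<union> left_mult g ` F \<union> c ` E \<Longrightarrow> norm (a * z) \<le> \<delta>"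
    using far_out_element[OF d _ assms(5-7)] by metis
  show thesis
  proof
    show "norm (right_mult g z) \<le> 1"
      using norm_right_mult_apply[of g z] mult_mono[OF g z(1)] by simp
    show "norm (right_mult g z * a) \<le> \<delta>" if "a \<in> F" for a
      using zF(1)[of "left_mult g a"] that by (simp add: right_mult_left_mult)
    show "norm (a * right_mult g z) \<le> \<delta>" if "a \<in> F" for a
    proof -
      have "norm (right_mult g (a * z)) \<le> (1/2) * \<delta>"
        using zF(2)[of a] that g
        by (intro order_trans[OF norm_right_mult_apply] mult_mono) auto
      then show ?thesis using \<open>0 < \<delta>\<close> by (simp add: right_mult_mult)
    qed
    show "norm (right_mult m (right_mult g z)) \<le> 3 * \<delta>" if "m \<in> E" for m
    proof -
      have "right_mult m (right_mult g z) = right_mult (g * m - of_algebra (c m)) z + z * c m"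
        by (simp add: multiplier_simps right_mult_of_algebra blinfun.diff_left)
      also have "norm \<dots> \<le> norm (right_mult (g * m - of_algebra (c m)) z) + norm (z * c m)"
        by (rule norm_triangle_ineq)
      also have "\<dots> \<le> \<delta> * 2 + \<delta>"
        using c[OF that] z(1) zF(1)[of "c m"] that \<open>0 < \<delta>\<close>
        by (intro add_mono order_trans[OF norm_right_mult_apply] mult_mono) auto
      finally show ?thesis by simp
    qed
    show "norm (right_mult b (right_mult g z)) > \<epsilon>"
      using z(2) by (simp add: multiplier_simps)
  qed
qed

section \<open>Strict limits and annihilators in the corona\<close>

text \<open>The pointwise limits of left and right multiplication by \<open>S n\<close> are bounded
  by \<open>C\<close>, and associativity passes to the limit as the double-centralizer
  identities.\<close>

lemma strict_limit_multiplier: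
  fixes S :: "nat \<Rightarrow> 'a::cstar_algebra"
  assumes bound: "\<And>n. norm (S n) \<le> C"
    and "\<And>a. convergent (\<lambda>n. S n * a)" "\<And>a. convergent (\<lambda>n. a * S n)"
  obtains X where "\<And>a. (\<lambda>n. S n * a) \<longlonglongrightarrow> left_mult X a" "\<And>a. (\<lambda>n. a * S n) \<longlonglongrightarrow> right_mult X a"
proof -
  define L R where "L a = lim (\<lambda>n. S n * a)" and "R a = lim (\<lambda>n. a * S n)" for a
  have L: "(\<lambda>n. S n * a) \<longlonglongrightarrow> L a" and R: "(\<lambda>n. a * S n) \<longlonglongrightarrow> R a" for a
    using assms(2,3) by (simp_all add: L_def R_def convergent_LIMSEQ_iff)
  have bL: "bounded_linear L"
  proof (rule bounded_linear_intro[where K = C])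
    show "L (a + b) = L a + L b" for a b
      using LIMSEQ_unique[OF L[of "a + b"]] tendsto_add[OF L[of a] L[of b]] by (simp add: distrib_left)
    show "L (r *\<^sub>R a) = r *\<^sub>R L a" for r a
      using LIMSEQ_unique[OF L[of "r *\<^sub>R a"]] tendsto_scaleR[OF tendsto_const L[of a], of r] by simp
    show "norm (L a) \<le> norm a * C" for a
      by (rule LIMSEQ_le_const2[OF tendsto_norm[OF L]])
        (use bound in \<open>auto intro!: exI[of _ 0] order_trans[OF norm_mult_ineq] mult_right_mono simp: mult.commute[of _ C]\<close>)
  qed
  have bR: "bounded_linear R"
  proof (rule bounded_linear_intro[where K = C])
    show "R (a + b) = R a + R b" for a b
      using LIMSEQ_unique[OF R[of "a + b"]] tendsto_add[OF R[of a] R[of b]] by (simp add: distrib_right)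
    show "R (r *\<^sub>R a) = r *\<^sub>R R a" for r a
      using LIMSEQ_unique[OF R[of "r *\<^sub>R a"]] tendsto_scaleR[OF tendsto_const R[of a], of r] by simp
    show "norm (R a) \<le> norm a * C" for a
      by (rule LIMSEQ_le_const2[OF tendsto_norm[OF R]])
        (use bound in \<open>auto intro!: exI[of _ 0] order_trans[OF norm_mult_ineq] mult_left_mono\<close>)
  qed
  have "L (c *\<^sub>C a) = c *\<^sub>C L a" "R (c *\<^sub>C a) = c *\<^sub>C R a" for c a
    using LIMSEQ_unique[OF L[of "c *\<^sub>C a"]] LIMSEQ_unique[OF R[of "c *\<^sub>C a"]]
      bounded_linear.tendsto[OF bounded_linear_scaleC_right L[of a]]
      bounded_linear.tendsto[OF bounded_linear_scaleC_right R[of a]]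
    by (simp_all add: mult_scaleC_left mult_scaleC_right)
  moreover have "L (a * b) = L a * b" for a b
    using LIMSEQ_unique[OF L[of "a * b"]] tendsto_mult_right[OF L[of a], of b]
    by (simp add: mult.assoc)
  moreover have "R (a * b) = a * R b" for a b
    using LIMSEQ_unique[OF R[of "a * b"]] tendsto_mult_left[OF R[of b], of a]
    by (simp add: mult.assoc)
  moreover have "R a * b = a * L b" for a b
    using LIMSEQ_unique[OF tendsto_mult_right[OF R[of a], of b]] tendsto_mult_left[OF L[of b], of a]
    by (simp add: mult.assoc)
  ultimately have "Rep_multiplier (Abs_multiplier (Blinfun L, Blinfun R)) = (Blinfun L, Blinfun R)"
    by (intro Abs_multiplier_inverse)
      (simp add: bounded_ops_def bounded_linear_Blinfun_apply bL bR)
  then have "left_mult (Abs_multiplier (Blinfun L, Blinfun R)) a = L a"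
    "right_mult (Abs_multiplier (Blinfun L, Blinfun R)) a = R a" for a
    by (simp_all add: left_mult_def right_mult_def bounded_linear_Blinfun_apply bL bR)
  with L R show thesis
    by (intro that[of "Abs_multiplier (Blinfun L, Blinfun R)"]) simp_all
qed

text \<open>The products S_n m converge strictly to X m and in norm to \<open>s\<close>; the two
  limits agree as multipliers.\<close>

lemma strict_limit_mult_in_ideal:
  fixes S :: "nat \<Rightarrow> 'a::cstar_algebra"
  assumes X: "\<And>a. (\<lambda>n. S n * a) \<longlonglongrightarrow> left_mult X a" "\<And>a. (\<lambda>n. a * S n) \<longlonglongrightarrow> right_mult X a"
    and "(\<lambda>n. right_mult m (S n)) \<longlonglongrightarrow> s"
  shows "X * m \<in> ideal_of_algebra"
proof (rule range_eqI, rule multiplier_eqI; rule blinfun_eqI)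
  fix a
  have "(\<lambda>n. right_mult m (S n) * a) \<longlonglongrightarrow> left_mult (X * m) a"
    using X(1)[of "left_mult m a"] by (simp add: right_mult_left_mult multiplier_simps)
  then show "left_mult (X * m) a = left_mult (of_algebra s) a"
    using tendsto_mult_right[OF assms(3), of a] LIMSEQ_unique by (simp add: left_mult_of_algebra) blast
  have "(\<lambda>n. right_mult m (a * S n)) \<longlonglongrightarrow> right_mult (X * m) a"
    using bounded_linear.tendsto[OF blinfun.bounded_linear_right X(2)[of a]] by (simp add: multiplier_simps)
  then show "right_mult (X * m) a = right_mult (of_algebra s) a"
    using tendsto_mult_left[OF assms(3), of a] LIMSEQ_unique
    by (simp add: right_mult_of_algebra right_mult_mult) blast
qed

text \<open>Equiboundedness permits a three-epsilon argument. Strict convergence thus need only be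
  tested on elements such as \<open>d i * a\<close>.\<close>

lemma convergent_on_approximate_unit:
  fixes f :: "nat \<Rightarrow> 'a::real_normed_vector \<Rightarrow> 'b::banach"
  assumes "\<And>n. linear (f n)" "\<And>n a. norm (f n a) \<le> C * norm a" "0 \<le> C"
    and "u \<longlonglongrightarrow> a" and "\<And>i. convergent (\<lambda>n. f n (u i))"
  shows "convergent (\<lambda>n. f n a)"
proof -
  have "Cauchy (\<lambda>n. f n a)"
  proof (rule CauchyI)
    fix e :: real
    assume "0 < e"
    \<comment> \<open>\<open>C + 1\<close> avoids division by zero and makes
      \<open>C * e' < e / 3\<close> strict.\<close>
    define e' where "e' = e / (3 * (C + 1))"
    have e': "0 < e'" "C * e' < e / 3"
      using \<open>0 < e\<close> \<open>0 \<le> C\<close> by (auto simp: e'_def field_simps)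
    obtain i where "dist (u i) a < e'"
      using metric_LIMSEQ_D[OF assms(4) e'(1)] by blast
    then have ui: "norm (a - u i) \<le> e'" by (simp add: dist_norm norm_minus_commute)
    have near: "norm (f n a - f n (u i)) < e / 3" for n
    proof -
      have "f n a - f n (u i) = f n (a - u i)" using assms(1) by (simp add: linear_diff)
      then show ?thesis
        using assms(2)[of n "a - u i"] mult_left_mono[OF ui assms(3)] e'(2) by simp
    qed
    obtain M where M: "\<And>m n. m \<ge> M \<Longrightarrow> n \<ge> M \<Longrightarrow> norm (f m (u i) - f n (u i)) < e / 3"
      using CauchyD[OF convergent_Cauchy[OF assms(5)[of i]], of "e / 3"] \<open>0 < e\<close> by auto
    have "norm (f m a - f n a) < e" if "m \<ge> M" "n \<ge> M" for m n
    proof -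
      have "f m a - f n a = (f m a - f m (u i)) + (f m (u i) - f n (u i)) - (f n a - f n (u i))" by simp
      then have "norm (f m a - f n a) \<le> norm (f m a - f m (u i)) + norm (f m (u i) - f n (u i)) + norm (f n a - f n (u i))"
        by (metis norm_triangle_le_diff norm_triangle_ineq add_right_mono)
      then show ?thesis using near[of m] near[of n] M[OF that] by simp
    qed
    then show "\<exists>M. \<forall>m\<ge>M. \<forall>n\<ge>M. norm (f m a - f n a) < e" by blast
  qed
  then show ?thesis by (rule Cauchy_convergent)
qed

lemma near_orthogonal_sequence:
  fixes b :: "'a::cstar_algebra multiplier" and e g :: "nat \<Rightarrow> 'a multiplier" and d :: "nat \<Rightarrow> 'a"
  assumes d: "\<And>n. norm (d n) \<le> 1" "\<And>a. (\<lambda>n. d n * a) \<longlonglongrightarrow> a" "\<And>a. (\<lambda>n. a * d n) \<longlonglongrightarrow> a"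
    and "0 \<le> \<epsilon>" and g: "\<And>n. norm (g n) \<le> 1/2" "\<And>n. infdist (g n * b) ideal_of_algebra > \<epsilon>"
    and ge: "\<And>m n. m \<le> n \<Longrightarrow> infdist (g n * e m) ideal_of_algebra < \<delta> n"
    and \<delta>: "\<And>n. 0 < \<delta> n"
  obtains w where "\<And>n. norm (w n) \<le> 1" "\<And>n. norm (right_mult b (w n)) > \<epsilon>"
    "\<And>m n. m \<le> n \<Longrightarrow> norm (right_mult (e m) (w n)) \<le> 3 * \<delta> n"
    "\<And>i n. i \<le> n \<Longrightarrow> norm (w n * d i) \<le> \<delta> n" "\<And>i n. i \<le> n \<Longrightarrow> norm (d i * w n) \<le> \<delta> n"
    "\<And>i n. i < n \<Longrightarrow> norm (star (w i) * w n) \<le> \<delta> n"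
    "\<And>n. norm (w n * star (\<Sum>i<n. w i)) \<le> \<delta> n"
    "\<And>n. norm (star (\<Sum>i<n. w i) * w n) \<le> \<delta> n"
proof -
  \<comment> \<open>Each kind of member has its own use: the \<open>d i\<close> give strict
    convergence, the earlier \<open>star (w i)\<close> let a term be isolated, and the adjoint of
    the partial sum bounds the norm of the next one.\<close>
  define F where "F w n = d ` {..n} \<union> (\<lambda>i. star (w i)) ` {..<n} \<union> {star (\<Sum>i<n. w i)}"
    for w :: "nat \<Rightarrow> 'a" and n
  define P where "P w n r \<longleftrightarrow> norm r \<le> 1 \<and> norm (right_mult b r) > \<epsilon> \<and>
      (\<forall>m\<le>n. norm (right_mult (e m) r) \<le> 3 * \<delta> n) \<and>
      (\<forall>a\<in>F w n. norm (r * a) \<le> \<delta> n \<and> norm (a * r) \<le> \<delta> n)" for w n r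
  have "\<exists>w. \<forall>n. P w n (w n)"
  proof (rule dependent_wellorder_choice)
    show "P w n r = P w' n r" if "\<And>i. i < n \<Longrightarrow> w i = w' i" for w w' n r
    proof -
      have "F w n = F w' n" using that by (simp add: F_def cong: image_cong_simp)
      then show ?thesis by (simp add: P_def)
    qed
    show "\<exists>r. P w n r" for w n
    proof -
      have F: "finite (F w n)" by (simp add: F_def)
      have E: "infdist (g n * m) ideal_of_algebra < \<delta> n" if "m \<in> e ` {..n}" for m
        using that ge by auto
      obtain r where "norm r \<le> 1" "\<And>a. a \<in> F w n \<Longrightarrow> norm (r * a) \<le> \<delta> n"
        "\<And>a. a \<in> F w n \<Longrightarrow> norm (a * r) \<le> \<delta> n"
        "\<And>m. m \<in> e ` {..n} \<Longrightarrow> norm (right_mult m r) \<le> 3 * \<delta> n" "norm (right_mult b r) > \<epsilon>"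
        using far_out_multiple[OF d F \<delta> \<open>0 \<le> \<epsilon>\<close> g(2) g(1) _ E] by (metis finite_atMost finite_imageI)
      then show ?thesis unfolding P_def by blast
    qed
  qed
  then obtain w where w: "\<And>n. P w n (w n)" by blast
  show thesis
    by (rule that[of w]; use w in \<open>force simp: P_def F_def\<close>)
qed

lemma norm_partial_sums_near_orthogonal:
  fixes w :: "nat \<Rightarrow> 'a::cstar_algebra"
  assumes "\<And>n. norm (w n) \<le> 1"
    and "\<And>n. norm (w n * star (\<Sum>i<n. w i)) \<le> (1/4) ^ n / 32"
    and "\<And>n. norm (star (\<Sum>i<n. w i) * w n) \<le> (1/4) ^ n / 32"
  shows "norm (\<Sum>i<n. w i) \<le> 2"
proof -
  \<comment> \<open>Strengthened for induction; the bound starts at 1, the least admissible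
    \<open>K\<close>. The factor 1 + \<eta> with \<eta> = (1/2)^n / 4 adds at most half of (1/2)^n,
    and \<eta>^2 / 2 is the tolerance (1/4)^n / 32.\<close>
  have "norm (\<Sum>i<n. w i) \<le> 2 - (1/2) ^ n"
  proof (induction n)
    case (Suc n)
    let ?S = "\<Sum>i<n. w i" and ?\<eta> = "(1/2) ^ n / 4 :: real"
    have h: "(1/2::real) ^ n \<le> 1" "0 < (1/2::real) ^ n" by (simp_all add: power_le_one)
    have \<eta>: "?\<eta>\<^sup>2 / 2 = (1/4) ^ n / 32"
      by (simp add: power2_eq_square power_divide flip: power_mult_distrib)
    have "norm (?S * star (w n)) = norm (w n * star ?S)"
      using norm_star[of "?S * star (w n)"] by (simp add: star_mult star_star)
    then have "norm (?S + w n) \<le> (2 - (1/2) ^ n) * (1 + ?\<eta>)"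
      using Suc assms[of n] h
      by (intro norm_add_near_orthogonal) (auto simp only: \<eta>)
    also have "\<dots> \<le> 2 - (1/2) ^ Suc n"
      using h by (simp add: algebra_simps)
    finally show ?case by simp
  qed simp
  also have "\<dots> \<le> 2" by simp
  finally show ?thesis .
qed


text \<open>\<open>X\<close> is the strictly convergent sum of a near-orthogonal sequence \<open>w\<close>. It is killed by
  every \<open>e m\<close> because the sum of the \<open>w n * e m\<close> converges in norm, but not by \<open>b\<close>: multiplying
  \<open>X * b\<close> by \<open>star (w j)\<close> isolates \<open>star (w j) * w j * b\<close>, which stays large, whereas
  \<open>star (w j) * s\<close> tends to 0 for \<open>s\<close> in the algebra.\<close>

lemma multiplier_annihilator:
  fixes b :: "'a::cstar_algebra multiplier" and e g :: "nat \<Rightarrow> 'a multiplier" and d :: "nat \<Rightarrow> 'a"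
  assumes d: "\<And>n. norm (d n) \<le> 1" "\<And>a. (\<lambda>n. d n * a) \<longlonglongrightarrow> a" "\<And>a. (\<lambda>n. a * d n) \<longlonglongrightarrow> a"
    and "0 < \<epsilon>" and g: "\<And>n. norm (g n) \<le> 1/2" "\<And>n. infdist (g n * b) ideal_of_algebra > \<epsilon>"
    and ge: "\<And>m n. m \<le> n \<Longrightarrow> infdist (g n * e m) ideal_of_algebra < (1/4) ^ n / 32"
  obtains X where "\<And>m. X * e m \<in> ideal_of_algebra" "X * b \<notin> ideal_of_algebra"
proof -
  define \<delta> where "\<delta> n = (1/4::real) ^ n / 32" for n
  have \<delta>: "0 < \<delta> n" for n by (simp add: \<delta>_def)
  have sum_\<delta>: "summable \<delta>" unfolding \<delta>_def by (intro summable_divide summable_geometric) simp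
  have \<delta>_tail: "(\<Sum>i=j..<n. \<delta> i) \<le> 2 * \<delta> j" for j n
  proof -
    \<comment> \<open>The subtracted term makes the induction close, because \<delta> shrinks by the
      factor 1/4.\<close>
    have "(\<Sum>i=j..<n. \<delta> i) \<le> 2 * \<delta> j - 2 * \<delta> n" if "j \<le> n"
      using that
    proof (induction n rule: dec_induct)
      case (step n)
      moreover have "\<delta> (Suc n) = \<delta> n / 4" by (simp add: \<delta>_def)
      ultimately show ?case using \<delta>[of n] by simp
    qed (use \<delta>[of j] in simp)
    then show ?thesis using \<delta>[of n] \<delta>[of j] by (cases "j \<le> n") auto
  qed
  obtain w where w1: "\<And>n. norm (w n) \<le> 1" and wb: "\<And>n. norm (right_mult b (w n)) > \<epsilon>"
    and we: "\<And>m n. m \<le> n \<Longrightarrow> norm (right_mult (e m) (w n)) \<le> 3 * \<delta> n"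
    and wd: "\<And>i n. i \<le> n \<Longrightarrow> norm (w n * d i) \<le> \<delta> n"
    and dw: "\<And>i n. i \<le> n \<Longrightarrow> norm (d i * w n) \<le> \<delta> n"
    and ww: "\<And>i n. i < n \<Longrightarrow> norm (star (w i) * w n) \<le> \<delta> n"
    and wS: "\<And>n. norm (w n * star (\<Sum>i<n. w i)) \<le> \<delta> n"
      "\<And>n. norm (star (\<Sum>i<n. w i) * w n) \<le> \<delta> n"
  proof (rule near_orthogonal_sequence[of d \<epsilon> g b e \<delta>])
    show "infdist (g n * e m) ideal_of_algebra < \<delta> n" if "m \<le> n" for m n
      using ge[OF that] by (simp add: \<delta>_def)
  qed (use d \<open>0 < \<epsilon>\<close> g \<delta> in \<open>auto intro: that\<close>)
  define S where "S n = (\<Sum>i<n. w i)" for n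
  have S2: "norm (S n) \<le> 2" for n
    using norm_partial_sums_near_orthogonal[OF w1 wS[unfolded \<delta>_def]] by (simp add: S_def)
  have convergent_sum: "convergent (\<lambda>n. \<Sum>i<n. f i)"
    if "\<And>n. n \<ge> N \<Longrightarrow> norm (f n) \<le> 3 * \<delta> n" for f :: "nat \<Rightarrow> 'a" and N
    using that unfolding summable_iff_convergent[symmetric]
    by (intro summable_comparison_test[OF _ summable_mult[OF sum_\<delta>, of 3]]) blast
  \<comment> \<open>Against a fixed \<open>d i\<close> the series is dominated by \<delta> from
    index \<open>i\<close> on; the bound 2 on the partial sums extends convergence to every
    \<open>a\<close>.\<close>
  have left: "convergent (\<lambda>n. S n * a)" for a
  proof (rule convergent_on_approximate_unit[where f = "\<lambda>n a. S n * a" and C = 2])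
    show "(\<lambda>i. d i * a) \<longlonglongrightarrow> a" by (rule d)
    have "convergent (\<lambda>n. S n * d i)" for i
      unfolding S_def sum_distrib_right
      by (rule convergent_sum[of i], rule order_trans[OF wd]) (simp_all add: less_imp_le[OF \<delta>])
    then show "convergent (\<lambda>n. S n * (d i * a))" for i
      unfolding convergent_def mult.assoc[symmetric] using tendsto_mult_right by blast
    show "norm (S n * x) \<le> 2 * norm x" for n x
      using S2[of n] by (intro order_trans[OF norm_mult_ineq] mult_right_mono) auto
  qed (auto intro!: linearI simp: distrib_left)
  have right: "convergent (\<lambda>n. a * S n)" for a
  proof (rule convergent_on_approximate_unit[where f = "\<lambda>n a. a * S n" and C = 2])
    show "(\<lambda>i. a * d i) \<longlonglongrightarrow> a" by (rule d)
    have "convergent (\<lambda>n. d i * S n)" for i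
      unfolding S_def sum_distrib_left
      by (rule convergent_sum[of i], rule order_trans[OF dw]) (simp_all add: less_imp_le[OF \<delta>])
    then show "convergent (\<lambda>n. (a * d i) * S n)" for i
      unfolding convergent_def mult.assoc using tendsto_mult_left by blast
    show "norm (x * S n) \<le> 2 * norm x" for n x
      using S2[of n] mult_left_mono[OF S2[of n], of "norm x"] norm_mult_ineq[of x "S n"] by simp
  qed (auto intro!: linearI simp: distrib_right)
  obtain X where X: "\<And>a. (\<lambda>n. S n * a) \<longlonglongrightarrow> left_mult X a" "\<And>a. (\<lambda>n. a * S n) \<longlonglongrightarrow> right_mult X a"
    using strict_limit_multiplier[OF S2 left right] by blast
  have "X * e m \<in> ideal_of_algebra" for m
  proof -
    have "convergent (\<lambda>n. right_mult (e m) (S n))"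
      unfolding S_def blinfun.sum_right by (rule convergent_sum[of m]) (rule we)
    then show ?thesis using strict_limit_mult_in_ideal[OF X] by (auto simp: convergent_def)
  qed
  moreover have "X * b \<notin> ideal_of_algebra"
  proof
    assume "X * b \<in> ideal_of_algebra"
    then obtain s where s: "X * b = of_algebra s" by blast
    \<comment> \<open>Terms before \<open>j\<close> are handled together through \<open>S j\<close>,
      later ones individually by the geometric tail.\<close>
    have isolate: "norm (right_mult X (star (w j)) - star (w j) * w j) \<le> 3 * \<delta> j" for j
    proof (rule LIMSEQ_le_const2[OF tendsto_norm[OF tendsto_diff[OF X(2) tendsto_const]]])
      have "norm (star (w j) * S n - star (w j) * w j) \<le> 3 * \<delta> j" if "n > j" for n
      proof -
        have "S n = S j + w j + (\<Sum>i=Suc j..<n. w i)"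
          using sum.atLeastLessThan_concat[of 0 "Suc j" n w] that
          by (simp add: S_def atLeast0LessThan)
        then have "star (w j) * S n - star (w j) * w j =
            star (w j) * S j + (\<Sum>i=Suc j..<n. star (w j) * w i)"
          by (simp add: distrib_left sum_distrib_left)
        also have "norm \<dots> \<le> norm (star (w j) * S j) + (\<Sum>i=Suc j..<n. norm (star (w j) * w i))"
          by (intro order_trans[OF norm_triangle_ineq] add_left_mono norm_sum)
        also have "\<dots> \<le> \<delta> j + (\<Sum>i=Suc j..<n. \<delta> i)"
        proof (intro add_mono sum_mono ww)
          show "norm (star (w j) * S j) \<le> \<delta> j"
            using wS(2)[of j] norm_star[of "star (w j) * S j"] by (simp add: S_def star_mult star_star)
        qed simp
        also have "\<dots> \<le> \<delta> j + 2 * \<delta> (Suc j)" using \<delta>_tail by simp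
        also have "\<dots> \<le> 3 * \<delta> j" by (simp add: \<delta>_def)
        finally show ?thesis .
      qed
      then show "\<exists>N. \<forall>n\<ge>N. norm (star (w j) * S n - star (w j) * w j) \<le> 3 * \<delta> j"
        by (intro exI[of _ "Suc j"]) auto
    qed
    have \<delta>0: "\<delta> \<longlonglongrightarrow> 0" using summable_LIMSEQ_zero[OF sum_\<delta>] .
    \<comment> \<open>Taking adjoints, \<open>star s * w j\<close> is compared with
      \<open>star s * (d i * w j)\<close>, which is small once \<open>j\<close> is at least
      \<open>i\<close>.\<close>
    have ws: "(\<lambda>j. star (w j) * s) \<longlonglongrightarrow> 0"
    proof (rule tendstoI)
      fix r :: real
      assume "0 < r"
      then obtain i where i: "dist (star s * d i) (star s) < r / 2"
        using metric_LIMSEQ_D[OF d(3)[of "star s"], of "r / 2"] by auto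
      have "\<forall>\<^sub>F j in sequentially. norm s * \<delta> j < r / 2"
        by (rule order_tendstoD(2)[OF tendsto_mult_right_zero[OF \<delta>0]]) (use \<open>0 < r\<close> in simp)
      then show "\<forall>\<^sub>F j in sequentially. dist (star (w j) * s) 0 < r"
        using eventually_ge_at_top[of i]
      proof eventually_elim
        case (elim j)
        have "norm (star (w j) * s) = norm ((star s - star s * d i) * w j + star s * (d i * w j))"
          using norm_star[of "star (w j) * s"]
          by (simp add: star_mult star_star left_diff_distrib mult.assoc)
        also have "\<dots> \<le> norm (star s - star s * d i) * norm (w j) + norm (star s) * norm (d i * w j)"
          by (intro order_trans[OF norm_triangle_ineq] add_mono norm_mult_ineq)
        also have "\<dots> \<le> norm (star s - star s * d i) * 1 + norm s * \<delta> j"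
          using w1[of j] dw[OF elim(2)] by (intro add_mono mult_mono) (auto simp: norm_star)
        also have "\<dots> < r" using i elim(1) by (simp add: dist_norm norm_minus_commute)
        finally show ?case by simp
      qed
    qed
    \<comment> \<open>By the C*-identity, the squared norm of w_j b is at most the norm of b times
      that of w_j^* w_j b, and the latter is close to w_j^* X b = w_j^* s.\<close>
    have lower: "\<epsilon>\<^sup>2 \<le> norm b * (norm (star (w j) * s) + norm b * (3 * \<delta> j))" for j
    proof -
      let ?v = "right_mult b (w j)"
      have "star (w j) * s = right_mult (X * b) (star (w j))"
        by (simp add: s right_mult_of_algebra)
      then have "star (w j) * ?v - star (w j) * s =
          - right_mult b (right_mult X (star (w j)) - star (w j) * w j)"
        by (simp add: multiplier_simps right_mult_mult blinfun.diff_right)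
      then have "norm (star (w j) * ?v - star (w j) * s) \<le> norm b * (3 * \<delta> j)"
        using norm_right_mult_apply[of b "right_mult X (star (w j)) - star (w j) * w j"]
          mult_left_mono[OF isolate[of j], of "norm b"] by simp
      then have wv: "norm (star (w j) * ?v) \<le> norm (star (w j) * s) + norm b * (3 * \<delta> j)"
        using norm_triangle_sub[of "star (w j) * ?v" "star (w j) * s"] by simp
      have "\<epsilon>\<^sup>2 \<le> (norm ?v)\<^sup>2" using wb[of j] \<open>0 < \<epsilon>\<close> by (intro power_mono) auto
      also have "\<dots> = norm (star ?v * ?v)" by (simp add: cstar_identity)
      also have "star ?v = left_mult (star b) (star (w j))"
        by (simp add: multiplier_simps star_conj.rep_eq star_star)
      also have "left_mult (star b) (star (w j)) * ?v = left_mult (star b) (star (w j) * ?v)"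
        by (simp add: left_mult_mult)
      also have "norm \<dots> \<le> norm b * norm (star (w j) * ?v)"
        using norm_left_mult_apply[of "star b"] by (simp add: norm_star)
      also have "\<dots> \<le> norm b * (norm (star (w j) * s) + norm b * (3 * \<delta> j))"
        by (intro mult_left_mono wv) simp
      finally show ?thesis .
    qed
    have "(\<lambda>j. norm b * (norm (star (w j) * s) + norm b * (3 * \<delta> j))) \<longlonglongrightarrow> norm b * (0 + norm b * (3 * 0))"
      by (intro tendsto_intros \<delta>0 tendsto_norm_zero ws)
    then have "\<epsilon>\<^sup>2 \<le> norm b * (0 + norm b * (3 * 0))"
      by (rule LIMSEQ_le_const) (use lower in blast)
    then show False using \<open>0 < \<epsilon>\<close> by simp
  qed
  ultimately show thesis by (rule that)
qed

lemma corona_annihilator: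
  fixes b :: "'a::cstar_algebra corona" and e :: "nat \<Rightarrow> 'a corona"
  assumes unital: "sigma_unital (UNIV :: 'a set)"
    and e: "\<And>n. norm (e n) \<le> 1" "\<And>m. (\<lambda>n. e n * e m) \<longlonglongrightarrow> e m"
    and nonconv: "\<not> (\<lambda>n. e n * b) \<longlonglongrightarrow> b"
  obtains x where "\<And>m. x * e m = 0" "x * b \<noteq> 0"
proof -
  obtain d :: "nat \<Rightarrow> 'a" where d: "\<And>n. norm (d n) \<le> 1" "\<And>a. (\<lambda>n. d n * a) \<longlonglongrightarrow> a" "\<And>a. (\<lambda>n. a * d n) \<longlonglongrightarrow> a"
    using unital unfolding sigma_unital_def by auto
  obtain \<epsilon> where "\<epsilon> > 0" and far: "\<And>N. \<exists>n\<ge>N. dist (e n * b) b \<ge> \<epsilon>"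
    using nonconv by (auto simp: lim_sequentially not_less)
  have "\<exists>m. e n = abs_corona m" for n by (rule abs_corona_surj[of "e n"]) blast
  then obtain eL where eL: "\<And>m. e m = abs_corona (eL m)" by metis
  obtain bL where bL: "b = abs_corona bL" by (rule abs_corona_surj)
  \<comment> \<open>For late n, 1 - e_n nearly kills e_0, ..., e_j, while nonconvergence supplies
    arbitrarily late n for which (1 - e_n) b has norm at least \<epsilon>. After scaling this is
    \<epsilon>/6; halving makes the bound strict.\<close>
  have "\<exists>g. norm g \<le> 1/2 \<and> infdist (g * bL) ideal_of_algebra > \<epsilon> / 12 \<and>
      (\<forall>m\<le>j. infdist (g * eL m) ideal_of_algebra < (1/4) ^ j / 32)" for j
  proof -
    have "\<forall>\<^sub>F n in sequentially. \<forall>m\<in>{..j}. dist (e n * e m) (e m) < (1/4) ^ j / 32"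
      by (intro eventually_ball_finite ballI tendstoD e) auto
    then obtain N where N: "\<And>n m. n \<ge> N \<Longrightarrow> m \<le> j \<Longrightarrow> dist (e n * e m) (e m) < (1/4) ^ j / 32"
      unfolding eventually_sequentially by auto
    obtain n where n: "n \<ge> N" "dist (e n * b) b \<ge> \<epsilon>" using far by blast
    \<comment> \<open>As 1 - e_n has norm at most 2, the factor 1/6 gives norm at most 1/3, leaving
      room for a lift of norm below 1/2.\<close>
    define \<gamma> where "\<gamma> = (1/6) *\<^sub>R (corona_one - e n)"
    have \<gamma>: "norm (\<gamma> * x) = dist (e n * x) x / 6" for x
      by (simp add: \<gamma>_def left_diff_distrib corona_one_mult dist_norm norm_minus_commute)
    have "norm \<gamma> < 1/2"
      using norm_triangle_ineq4[of corona_one "e n"] e(1)[of n] norm_corona_one_le[where 'a = 'a]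
      by (simp add: \<gamma>_def)
    then obtain g where g: "\<gamma> = abs_corona g" "norm g < norm \<gamma> + (1/2 - norm \<gamma>)"
      using corona_approx[of "1/2 - norm \<gamma>" \<gamma>] by auto
    have inf: "infdist (g * m) ideal_of_algebra = norm (\<gamma> * abs_corona m)" for m
      by (simp add: g(1) times_corona.abs_eq norm_corona.abs_eq)
    show ?thesis
    proof (intro exI[of _ g] conjI allI impI)
      show "norm g \<le> 1/2" using g(2) by simp
      show "infdist (g * bL) ideal_of_algebra > \<epsilon> / 12"
        using n(2) \<open>\<epsilon> > 0\<close> by (simp add: inf \<gamma> flip: bL)
      show "infdist (g * eL m) ideal_of_algebra < (1/4) ^ j / 32" if "m \<le> j" for m
      proof -
        have "dist (e n * e m) (e m) / 6 \<le> dist (e n * e m) (e m)" by simp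
        then show ?thesis using N[OF n(1) that] unfolding inf eL[symmetric] \<gamma> by linarith
      qed
    qed
  qed
  then obtain g where g: "\<And>n. norm (g n) \<le> 1/2" "\<And>n. infdist (g n * bL) ideal_of_algebra > \<epsilon> / 12"
    "\<And>m n. m \<le> n \<Longrightarrow> infdist (g n * eL m) ideal_of_algebra < (1/4) ^ n / 32" by metis
  have "\<epsilon> / 12 > 0" using \<open>\<epsilon> > 0\<close> by simp
  then obtain X where X: "\<And>m. X * eL m \<in> ideal_of_algebra" "X * bL \<notin> ideal_of_algebra"
    by (rule multiplier_annihilator[OF d _ g]) auto
  show thesis
    by (rule that[of "abs_corona X"])
      (use X in \<open>simp_all add: eL bL times_corona.abs_eq abs_corona_eq_0_iff\<close>)
qed

section \<open>Hereditary subalgebras and open projections\<close>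

lemma hereditary_memI_limits:
  fixes H :: "'a::cstar_algebra corona set"
  assumes her: "hereditary_cstar_subalgebra H" and e: "\<And>n. e n \<in> H" "\<And>n. norm (e n) \<le> 1"
    and b: "(\<lambda>n. e n * b) \<longlonglongrightarrow> b" "(\<lambda>n. b * e n) \<longlonglongrightarrow> b"
  shows "b \<in> H"
proof -
  have lim: "(\<lambda>n. e n * b * e n) \<longlonglongrightarrow> b"
  proof (rule Lim_transform2[OF b(2)])
    have "norm (b * e n - e n * b * e n) \<le> norm (b - e n * b)" for n
      using norm_mult_ineq[of "b - e n * b" "e n"] mult_left_mono[OF e(2)[of n], of "norm (b - e n * b)"]
      by (simp add: left_diff_distrib)
    moreover have "(\<lambda>n. norm (b - e n * b)) \<longlonglongrightarrow> 0"
      using tendsto_norm_zero[OF LIM_zero[OF b(1)]] by (simp add: norm_minus_commute)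
    ultimately show "(\<lambda>n. b * e n - e n * b * e n) \<longlonglongrightarrow> 0"
      by (rule Lim_null_comparison[OF always_eventually, OF allI])
  qed
  have "closed H"
    using her cstar_subalgebra_closed by (auto simp: hereditary_cstar_subalgebra_def)
  then show ?thesis
    by (rule closed_sequentially[OF _ _ lim]) (rule hereditary_sandwich[OF her e(1) e(1)])
qed

theorem theorem21:
  fixes \<pi> :: "'d::cstar_algebra corona \<Rightarrow> ('h::chilbert_space \<Rightarrow>\<^sub>L 'h)"
  assumes "sigma_unital (UNIV :: 'd set)"
    and "star_representation \<pi>" and "nondegenerate \<pi>" and "inj \<pi>"
  shows "\<forall>H :: 'd corona set. hereditary_cstar_subalgebra H \<and> sigma_unital H \<longrightarrow>
    (\<exists>p. projection p \<and> \<pi> ` H = {p o\<^sub>L T o\<^sub>L p | T. T \<in> bounded_ops} \<inter> range \<pi>)"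
proof (intro allI impI, elim conjE)
  fix H :: "'d corona set"
  assume her: "hereditary_cstar_subalgebra H" and "sigma_unital H"
  have H: "cstar_subalgebra H" using her by (simp add: hereditary_cstar_subalgebra_def)
  have \<pi>_mult: "\<pi> (a * b) \<xi> = \<pi> a (\<pi> b \<xi>)" and \<pi>_ops: "\<pi> a \<in> bounded_ops"
    and \<pi>_adj: "cinner (\<pi> (star a) \<xi>) \<eta> = cinner \<xi> (\<pi> a \<eta>)" for a b \<xi> \<eta>
    using assms(2) by (auto simp: star_representation_def is_adjoint_def)
  have \<pi>_adj': "cinner (\<pi> a \<xi>) \<eta> = cinner \<xi> (\<pi> (star a) \<eta>)" for a \<xi> \<eta>
    using \<pi>_adj[of "star a"] by (simp add: star_star)
  have \<pi>_0: "\<pi> 0 = 0"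
    using assms(2) unfolding star_representation_def by (metis add_cancel_right_left add_0)
  obtain e where epos: "\<And>n. e n \<in> positive_elements H" and e1: "\<And>n. norm (e n) \<le> 1"
    and e_lim: "\<And>a. a \<in> H \<Longrightarrow> (\<lambda>n. e n * a) \<longlonglongrightarrow> a" "\<And>a. a \<in> H \<Longrightarrow> (\<lambda>n. a * e n) \<longlonglongrightarrow> a"
    using \<open>sigma_unital H\<close> unfolding sigma_unital_def by blast
  have eH: "e n \<in> H" for n using positive_elements_subset[OF H] epos by blast
  have e_star: "star (e n) = e n" for n using positive_elements_self_adjoint[OF epos] .

  define V where "V = {\<pi> a \<xi> | a \<xi>. a \<in> H}"
  define K where "K = closure (span V)"
  have VK: "V \<subseteq> K" unfolding K_def using span_superset closure_subset by blast
  \<comment> \<open>An induction principle for \<open>K\<close>: closed linear conditions need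
    checking only on the vectors \<open>\<pi> a \<xi>\<close> with \<open>a \<in> H\<close>.\<close>
  have K_least: "K \<subseteq> {x. f x \<in> L}"
    if "bounded_linear f" "closed L" "subspace L" "\<And>a \<xi>. a \<in> H \<Longrightarrow> f (\<pi> a \<xi>) \<in> L"
    for f :: "'h \<Rightarrow> 'h" and L
    unfolding K_def
  proof (rule closure_minimal)
    have sub: "subspace {x. f x \<in> L}"
      using linear_subspace_vimage[OF bounded_linear.linear[OF that(1)] that(3)] by (simp add: vimage_def)
    show "span V \<subseteq> {x. f x \<in> L}"
      by (rule span_minimal[OF _ sub]) (use that(4) in \<open>auto simp: V_def\<close>)
    show "closed {x. f x \<in> L}"
      using closed_vimage[OF that(2) linear_continuous_on[OF that(1)]] by (simp add: vimage_def)
  qed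
  have K: "closed K" "subspace K" by (simp_all add: K_def subspace_closure subspace_span)
  \<comment> \<open>\<open>span\<close> is the real span, so complex scalars have to be moved onto
    \<xi> inside the generators.\<close>
  have K_scaleC: "c *\<^sub>C x \<in> K" if "x \<in> K" for c x
  proof -
    have "c *\<^sub>C \<pi> a \<xi> \<in> K" if "a \<in> H" for a \<xi>
    proof -
      have "c *\<^sub>C \<pi> a \<xi> = \<pi> a (c *\<^sub>C \<xi>)" using bounded_ops_scaleC[OF \<pi>_ops] by simp
      then show ?thesis using that VK by (auto simp: V_def)
    qed
    then show ?thesis using K_least[OF bounded_linear_scaleC_right K] that by blast
  qed
  obtain p where p: "projection p" and pK: "\<And>x. p x \<in> K" and pid: "\<And>x. x \<in> K \<Longrightarrow> p x = x"
    using projection_onto_closed_subspace[OF K] K_scaleC by blast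
  have p_adj: "cinner (p x) y = cinner x (p y)" for x y
    using p by (simp add: projection_def is_adjoint_def)

  have mem: "b \<in> H" if bT: "\<pi> b = p o\<^sub>L T o\<^sub>L p" for b T
  proof -
    have limit: "(\<lambda>n. e n * c) \<longlonglongrightarrow> c" if range: "\<And>\<xi>. \<pi> c \<xi> \<in> K" for c
    proof (rule ccontr)
      assume "\<not> (\<lambda>n. e n * c) \<longlonglongrightarrow> c"
      then obtain x where x: "\<And>m. x * e m = 0" "x * c \<noteq> 0"
        by (rule corona_annihilator[OF assms(1) e1 e_lim(1)[OF eH]]) auto
      have "\<pi> x (\<pi> a \<xi>) \<in> {0}" if "a \<in> H" for a \<xi>
      proof -
        have "(\<lambda>n. x * (e n * a)) \<longlonglongrightarrow> x * a" by (intro tendsto_mult_left e_lim that)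
        then have "x * a = 0" using x(1) by (simp add: LIMSEQ_const_iff flip: mult.assoc)
        then show ?thesis by (simp add: \<pi>_0 flip: \<pi>_mult)
      qed
      then have "K \<subseteq> {\<eta>. \<pi> x \<eta> \<in> {0}}"
        by (intro K_least) (auto simp: blinfun.bounded_linear_right)
      then have "\<pi> (x * c) = \<pi> 0" using range by (intro blinfun_eqI) (auto simp: \<pi>_mult \<pi>_0)
      then show False using x(2) assms(4) by (simp add: inj_eq)
    qed
    \<comment> \<open>The adjoint form of b = b p: it places the range of
      \<open>\<pi> (star b)\<close> in \<open>K\<close>, so that \<open>limit\<close> also applies
      to \<open>star b\<close>.\<close>
    have "\<pi> (star b) \<xi> = p (\<pi> (star b) \<xi>)" for \<xi>
    proof (rule cinner_ext)
      fix \<eta>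
      have "\<pi> b (p \<eta>) = \<pi> b \<eta>" by (simp add: bT pid pK)
      then show "cinner (\<pi> (star b) \<xi>) \<eta> = cinner (p (\<pi> (star b) \<xi>)) \<eta>"
        by (simp add: p_adj \<pi>_adj)
    qed
    then have "\<pi> (star b) \<xi> \<in> K" for \<xi> using pK by metis
    then have "(\<lambda>n. star (e n * star b)) \<longlonglongrightarrow> star (star b)"
      by (intro bounded_linear.tendsto[OF bounded_linear_star] limit)
    then have "(\<lambda>n. b * e n) \<longlonglongrightarrow> b" by (simp add: star_mult star_star e_star)
    moreover have "(\<lambda>n. e n * b) \<longlonglongrightarrow> b" by (rule limit) (simp add: bT pK)
    ultimately show ?thesis by (intro hereditary_memI_limits[OF her eH e1])
  qed
  \<comment> \<open>Since \<open>K\<close> contains the range of \<open>\<pi> a\<close>, p a = a;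
    the same for \<open>star a\<close> gives a p = a by taking adjoints.\<close>
  have corner: "\<pi> a = p o\<^sub>L \<pi> a o\<^sub>L p" if a: "a \<in> H" for a
  proof (rule blinfun_eqI)
    fix \<xi>
    have fix_range: "p (\<pi> a \<eta>) = \<pi> a \<eta>" if "a \<in> H" for a \<eta>
      using pid VK that by (auto simp: V_def)
    have "\<pi> a (p \<xi>) = \<pi> a \<xi>"
      by (rule cinner_ext) (simp add: \<pi>_adj' p_adj fix_range cstar_subalgebra_star[OF H a])
    then show "\<pi> a \<xi> = (p o\<^sub>L \<pi> a o\<^sub>L p) \<xi>" using fix_range[OF a] by simp
  qed
  have "\<pi> ` H = {p o\<^sub>L T o\<^sub>L p | T. T \<in> bounded_ops} \<inter> range \<pi>"
  proof (intro equalityI subsetI)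
    fix y assume "y \<in> \<pi> ` H"
    then obtain a where "y = \<pi> a" "a \<in> H" by blast
    then show "y \<in> {p o\<^sub>L T o\<^sub>L p | T. T \<in> bounded_ops} \<inter> range \<pi>"
      using corner[of a] \<pi>_ops[of a] by blast
  next
    fix y assume "y \<in> {p o\<^sub>L T o\<^sub>L p | T. T \<in> bounded_ops} \<inter> range \<pi>"
    then obtain T b where y: "y = p o\<^sub>L T o\<^sub>L p" and b: "y = \<pi> b" by blast
    from y have "\<pi> b = p o\<^sub>L T o\<^sub>L p" unfolding b .
    from mem[OF this] show "y \<in> \<pi> ` H" unfolding b by (rule imageI)
  qed
  from conjI[OF p this]
  show "\<exists>p. projection p \<and> \<pi> ` H = {p o\<^sub>L T o\<^sub>L p | T. T \<in> bounded_ops} \<inter> range \<pi>"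
    by (rule exI)
qed

end
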